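(* Let $\mathcal{M}=(\mathbb{R}^2,\nabla)$, where $\nabla$ is a torsion-free connection whose Christoffel symbols $\Gamma_{ij}{}^k=\Gamma_{ji}{}^k$ in the standard coordinates $(x^1,x^2)$ are constant and which is not flat. Let $\rho$ be the Ricci tensor and let $\mathfrak{K}(\mathcal{M})$ be the Lie algebra of affine Killing vector fields. Put $\mathfrak{K}_0^{\mathcal{A}}:=\operatorname{Span}_{\mathbb{R}}\{\partial_1,\partial_2\}$. \begin{enumerate} \item Suppose $\rho=\rho_{22}\,dx^2\otimes dx^2$. \begin{enumerate} \item If $\Gamma_{11}{}^1\ne0$, then $X\in\mathfrak{K}(\mathcal{M})$ if and only if $X=e^{-\Gamma_{11}{}^1x^1}\xi(x^2)\partial_1+X_0$ for some $X_0\in\mathfrak{K}_0^{\mathcal{A}}$ and some function $\xi$ satisfying $\xi''+(2\Gamma_{12}{}^1-\Gamma_{22}{}^2)\xi'+\Gamma_{11}{}^1\Gamma_{22}{}^1\xi=0$. \item If $\Gamma_{11}{}^1=0$, then $X\in\mathfrak{K}(\mathcal{M})$ if and only if $X=(\xi(x^2)+c_1x^1)\partial_1+X_0$ for some $X_0\in\mathfrak{K}_0^{\mathcal{A}}$, some $c_1\in\mathbb{R}$ and some function $\xi$ satisfying $\xi''+(2\Gamma_{12}{}^1-\Gamma_{22}{}^2)\xi'-c_1\Gamma_{22}{}^1=0$. \end{enumerate} \item The following assertions are equivalent: (a) $\dim\{\mathfrak{K}(\mathcal{M})\}=4$; (b) $\dim\{\mathfrak{K}(\mathcal{M})\}>2$;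 (c) $\operatorname{Rank}\{\rho\}=1$. \item The following assertions are equivalent: (a) $\dim\{\mathfrak{K}(\mathcal{M})\}=2$; (b) $\operatorname{Rank}\{\rho\}=2$. \end{enumerate}
   Context: Notation: $\partial_i:=\partial_{x^i}$, $\nabla_{\partial_i}\partial_j=\Gamma_{ij}{}^k\partial_k$ (sum over repeated indices). Curvature: $R(\xi_1,\xi_2)=\nabla_{\xi_1}\nabla_{\xi_2}-\nabla_{\xi_2}\nabla_{\xi_1}-\nabla_{[\xi_1,\xi_2]}$. Ricci tensor: $\rho(\xi_1,\xi_2)=\operatorname{Tr}\{\xi_3\mapsto R(\xi_3,\xi_1)\xi_2\}$ (it is symmetric when the Christoffel symbols are constant). A vector field $X$ is an affine Killing vector field if $\mathcal{L}_X\nabla=0$, i.e. $[X,\nabla_YZ]-\nabla_Y[X,Z]-\nabla_{[X,Y]}Z=0$ for all vector fields $Y,Z$; $\mathfrak{K}(\mathcal{M})$ is the real Lie algebra of such fields. *)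

theory Defs
  imports "HOL-Analysis.Analysis" "HOL-Library.Function_Algebras" "HOL-Library.Extended_Nat"
begin

text \<open>Pointwise real vector space structure on functions, so that the library's \<^const>\<open>span\<close>
  and \<^const>\<open>dim\<close> apply to spaces of vector fields.\<close>

instantiation "fun" :: (type, real_vector) real_vector
begin

definition scaleR_fun_def: "c *\<^sub>R f = (\<lambda>x. c *\<^sub>R f x)"

instance
  by standard (simp_all add: scaleR_fun_def fun_eq_iff scaleR_add_right scaleR_add_left)

end

text \<open>The library's \<^const>\<open>dim\<close> is 0 on infinite-dimensional spaces; here these get
  dimension \<open>\<infinity>\<close>.\<close>

definition edim :: "'a::real_vector set \<Rightarrow> enat" where
  "edim V = (if \<exists>B. finite B \<and> V \<subseteq> span B then enat (dim V) else \<infinity>)"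

type_synonym 'n vfield = "real^'n \<Rightarrow> real^'n"

primrec Ck :: "nat \<Rightarrow> ('a::real_normed_vector \<Rightarrow> 'b::real_normed_vector) \<Rightarrow> bool" where
  "Ck 0 f \<longleftrightarrow> continuous_on UNIV f"
| "Ck (Suc k) f \<longleftrightarrow>
     (\<forall>p. f differentiable (at p)) \<and> (\<forall>v. Ck k (\<lambda>p. frechet_derivative f (at p) v))"

text \<open>Intended for finite-dimensional domains, where continuity of all iterated directional
  derivatives is the usual notion of a \<open>C\<^sup>\<infinity>\<close> map.\<close>

definition smooth :: "('a::real_normed_vector \<Rightarrow> 'b::real_normed_vector) \<Rightarrow> bool" where
  "smooth f \<longleftrightarrow> (\<forall>k. Ck k f)"

definition coord_field :: "'n::finite \<Rightarrow> 'n vfield" where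
  "coord_field i = (\<lambda>p. axis i 1)"

definition lie_bracket :: "'n::finite vfield \<Rightarrow> 'n vfield \<Rightarrow> 'n vfield" where
  "lie_bracket X Y = (\<lambda>p. frechet_derivative Y (at p) (X p) - frechet_derivative X (at p) (Y p))"

text \<open>The connection on \<open>\<real>\<^sup>n\<close> with constant Christoffel symbols: \<open>\<Gamma> i j k\<close> has two lower
  indices \<open>i\<close>, \<open>j\<close> and upper index \<open>k\<close>, so that the covariant derivative of \<open>\<partial>\<^sub>j\<close> along
  \<open>\<partial>\<^sub>i\<close> is the sum of the \<open>\<Gamma> i j k \<partial>\<^sub>k\<close>.\<close>

definition cov :: "('n::finite \<Rightarrow> 'n \<Rightarrow> 'n \<Rightarrow> real) \<Rightarrow> 'n vfield \<Rightarrow> 'n vfield \<Rightarrow> 'n vfield" where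
  "cov \<Gamma> Y Z = (\<lambda>p. frechet_derivative Z (at p) (Y p)
                   + (\<chi> k. \<Sum>i\<in>UNIV. \<Sum>j\<in>UNIV. Y p $ i * Z p $ j * \<Gamma> i j k))"

definition curvature ::
  "('n::finite \<Rightarrow> 'n \<Rightarrow> 'n \<Rightarrow> real) \<Rightarrow> 'n vfield \<Rightarrow> 'n vfield \<Rightarrow> 'n vfield \<Rightarrow> 'n vfield" where
  "curvature \<Gamma> X Y Z =
     cov \<Gamma> X (cov \<Gamma> Y Z) - cov \<Gamma> Y (cov \<Gamma> X Z) - cov \<Gamma> (lie_bracket X Y) Z"

definition flat :: "('n::finite \<Rightarrow> 'n \<Rightarrow> 'n \<Rightarrow> real) \<Rightarrow> bool" where
  "flat \<Gamma> \<longleftrightarrow> (\<forall>X Y Z. smooth X \<longrightarrow> smooth Y \<longrightarrow> smooth Z \<longrightarrow> curvature \<Gamma> X Y Z = 0)"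

text \<open>The trace is that of an endomorphism of the tangent space at \<open>p\<close>; since the curvature is
  tensorial, a tangent vector \<open>w\<close> may be extended to the constant vector field.\<close>

definition ricci ::
  "('n::finite \<Rightarrow> 'n \<Rightarrow> 'n \<Rightarrow> real) \<Rightarrow> 'n vfield \<Rightarrow> 'n vfield \<Rightarrow> real^'n \<Rightarrow> real" where
  "ricci \<Gamma> X Y p = trace (matrix (\<lambda>w. curvature \<Gamma> (\<lambda>_. w) X Y p))"

definition ricci_matrix :: "('n::finite \<Rightarrow> 'n \<Rightarrow> 'n \<Rightarrow> real) \<Rightarrow> real^'n \<Rightarrow> real^'n^'n" where
  "ricci_matrix \<Gamma> p = (\<chi> i j. ricci \<Gamma> (coord_field i) (coord_field j) p)"

text \<open>Rank of the Ricci tensor; it is the same at every point as the symbols are constant.\<close>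

definition ricci_has_rank :: "('n::finite \<Rightarrow> 'n \<Rightarrow> 'n \<Rightarrow> real) \<Rightarrow> nat \<Rightarrow> bool" where
  "ricci_has_rank \<Gamma> r \<longleftrightarrow> (\<forall>p. rank (ricci_matrix \<Gamma> p) = r)"

definition killing :: "('n::finite \<Rightarrow> 'n \<Rightarrow> 'n \<Rightarrow> real) \<Rightarrow> 'n vfield set" where
  "killing \<Gamma> = {X. smooth X \<and> (\<forall>Y Z. smooth Y \<longrightarrow> smooth Z \<longrightarrow>
     lie_bracket X (cov \<Gamma> Y Z) - cov \<Gamma> Y (lie_bracket X Z) - cov \<Gamma> (lie_bracket X Y) Z = 0)}"

definition killing0 :: "2 vfield set" where
  "killing0 = span {coord_field 1, coord_field 2}"

end

theory Submission
  imports Defs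
begin

text \<open>Let \<open>B\<close> be the constant bilinear product given by the Christoffel symbols. A smooth field \<open>X\<close> is
  Killing iff \<open>D\<^sup>2X(v, w) = DX (B v w) - B (DX v) w - B v (DX w)\<close>. Commuting third derivatives shows
  that each \<open>L = DX(p)\<close> acts trivially, as a derivation, on the curvature, so \<open>L\<close> is skew for the
  Ricci form \<open>\<rho>\<close>.

  If \<open>\<rho>\<close> is nondegenerate, then \<open>\<rho> (D\<^sup>2X(u, v), w)\<close> is symmetric in \<open>u, v\<close> and skew in \<open>v, w\<close>, so it
  vanishes; thus \<open>L\<close> is a derivation of \<open>B\<close>, and a weight argument forces \<open>L = 0\<close> because \<open>B \<noteq> 0\<close>.
  If \<open>\<rho>\<close> has rank 1, a linear change of coordinates gives \<open>\<rho> = \<rho>\<^sub>2\<^sub>2 dx\<^sup>2 \<otimes> dx\<^sup>2\<close>, which forces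
  \<open>\<Gamma>\<^sub>1\<^sub>1\<^sup>2 = \<Gamma>\<^sub>1\<^sub>2\<^sup>2 = 0\<close>; skewness makes the second component of \<open>X\<close> constant, and the equations for the
  first one separate into an exponential in \<open>x\<^sup>1\<close> and a linear ODE in \<open>x\<^sup>2\<close>. The value of \<open>X\<close> and the
  gradient of its first component at the origin then parametrize the Killing fields by \<open>\<real>\<^sup>4\<close>.\<close>

section \<open>Calculus of smooth maps: closure properties, symmetry of second derivatives, product
  rule along a field\<close>

section \<open>Smooth maps\<close>

lemma smooth_has_derivative:
  assumes "smooth f"
  shows "(f has_derivative frechet_derivative f (at p)) (at p)"
proof -
  have "Ck (Suc 0) f" using assms unfolding smooth_def ..
  then show ?thesis by (simp add: frechet_derivative_works)
qed

lemma smooth_deriv: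
  assumes "smooth f"
  shows "smooth (\<lambda>p. frechet_derivative f (at p) v)"
  unfolding smooth_def
proof
  fix k
  have "Ck (Suc k) f" using assms unfolding smooth_def ..
  then show "Ck k (\<lambda>p. frechet_derivative f (at p) v)" by simp
qed

lemma smooth_continuous_on: "smooth f \<Longrightarrow> continuous_on UNIV f"
  unfolding smooth_def by (auto dest: spec[of _ 0])

text \<open>Induction on the order of differentiability, run for the whole class \<open>F\<close> at
  once, so that a directional derivative can be handed back to the class. The concrete smoothness
  proofs below choose an \<open>F\<close> closed under differentiation.\<close>

lemma smooth_coinduct:
  assumes "f \<in> F"
    and diff: "\<And>f p. f \<in> F \<Longrightarrow> f differentiable (at p)"
    and deriv: "\<And>f v. f \<in> F \<Longrightarrow> (\<lambda>p. frechet_derivative f (at p) v) \<in> F"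
  shows "smooth f"
proof -
  have "\<forall>f\<in>F. Ck k f" for k
  proof (induction k)
    case 0
    show ?case
      by (auto intro!: differentiable_imp_continuous_on simp: differentiable_on_def
          intro: differentiable_at_withinI diff)
  next
    case (Suc k)
    then show ?case using diff deriv by auto
  qed
  with \<open>f \<in> F\<close> show ?thesis by (auto simp: smooth_def)
qed

lemma smooth_const [simp]: "smooth (\<lambda>_. c)"
  by (rule smooth_coinduct[where F = "range (\<lambda>c _. c)"]) auto

lemma smooth_coord_field [simp]: "smooth (coord_field i)"
  by (simp add: coord_field_def)

lemma linear_frechet_derivative_smooth:
  "smooth f \<Longrightarrow> linear (frechet_derivative f (at p))"
  using smooth_has_derivative has_derivative_linear by blast

lemma frechet_derivative_comp_linear:
  assumes "smooth f" "bounded_linear S" "bounded_linear T"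
  shows "frechet_derivative (\<lambda>p. T (f (S p))) (at p) = (\<lambda>v. T (frechet_derivative f (at (S p)) (S v)))"
    and "(\<lambda>p. T (f (S p))) differentiable (at p)"
proof -
  have "((\<lambda>p. T (f (S p))) has_derivative (\<lambda>v. T (frechet_derivative f (at (S p)) (S v)))) (at p)"
    by (rule bounded_linear.has_derivative[OF assms(3)]
          has_derivative_compose[OF bounded_linear.has_derivative[OF assms(2) has_derivative_ident]
            smooth_has_derivative[OF assms(1)]])+
  then show "frechet_derivative (\<lambda>p. T (f (S p))) (at p) = (\<lambda>v. T (frechet_derivative f (at (S p)) (S v)))"
    and "(\<lambda>p. T (f (S p))) differentiable (at p)"
    by (auto simp: frechet_derivative_at[symmetric] differentiable_def)
qed

lemma smooth_comp_linear:
  assumes "smooth f" "bounded_linear S" "bounded_linear T"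
  shows "smooth (\<lambda>p. T (f (S p)))"
proof (rule smooth_coinduct[where F = "{\<lambda>p. T (g (S p)) | g. smooth g}"])
  show "(\<lambda>p. T (f (S p))) \<in> {\<lambda>p. T (g (S p)) |g. smooth g}" using assms by blast
next
  fix f' p assume "f' \<in> {\<lambda>p. T (g (S p)) |g. smooth g}"
  then show "f' differentiable (at p)"
    using frechet_derivative_comp_linear(2) assms by blast
next
  fix f' v assume "f' \<in> {\<lambda>p. T (g (S p)) |g. smooth g}"
  then show "(\<lambda>p. frechet_derivative f' (at p) v) \<in> {\<lambda>p. T (g (S p)) |g. smooth g}"
    using smooth_deriv frechet_derivative_comp_linear(1)[OF _ assms(2,3)] by fastforce
qed

text \<open>The mean value theorem is applied twice to the second difference over the parallelogram
  spanned by \<open>h *\<^sub>R v\<close> and \<open>h *\<^sub>R w\<close>: first in direction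
  \<open>v\<close> to the difference \<open>\<phi>\<close> of \<open>f\<close> along two parallel
  sides, then in direction \<open>w\<close> to the derivative obtained.\<close>

lemma double_mean_value:
  fixes f :: "'a::real_normed_vector \<Rightarrow> real"
  assumes "smooth f" and h: "h > 0"
  obtains s t where "0 < s" "s < h" "0 < t" "t < h"
    "f (p + h *\<^sub>R v + h *\<^sub>R w) - f (p + h *\<^sub>R v) - f (p + h *\<^sub>R w) + f p =
      h * h * frechet_derivative (\<lambda>q. frechet_derivative f (at q) v) (at (p + s *\<^sub>R v + t *\<^sub>R w)) w"
proof -
  let ?g = "\<lambda>q. frechet_derivative f (at q) v"
  have df: "((\<lambda>s. f (q + s *\<^sub>R v)) has_real_derivative ?g (q + s *\<^sub>R v)) (at s)" for q s
  proof -
    have "((\<lambda>s. f (q + s *\<^sub>R v)) has_derivative (\<lambda>x. frechet_derivative f (at (q + s *\<^sub>R v)) (x *\<^sub>R v))) (at s)"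
      by (rule has_derivative_compose[OF _ smooth_has_derivative[OF assms(1)]])
        (auto intro!: derivative_eq_intros)
    then show ?thesis
      by (simp add: has_field_derivative_def linear_scale[OF linear_frechet_derivative_smooth[OF assms(1)]]
          mult_commute_abs)
  qed
  have dg: "((\<lambda>s. ?g (q + s *\<^sub>R w)) has_real_derivative frechet_derivative ?g (at (q + s *\<^sub>R w)) w) (at s)" for q s
  proof -
    have "((\<lambda>s. ?g (q + s *\<^sub>R w)) has_derivative (\<lambda>x. frechet_derivative ?g (at (q + s *\<^sub>R w)) (x *\<^sub>R w))) (at s)"
      by (rule has_derivative_compose[OF _ smooth_has_derivative[OF smooth_deriv[OF assms(1)]]])
        (auto intro!: derivative_eq_intros)
    then show ?thesis
      by (simp add: has_field_derivative_def linear_scale[OF linear_frechet_derivative_smooth[OF smooth_deriv[OF assms(1)]]]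
          mult_commute_abs)
  qed
  define \<phi> where "\<phi> = (\<lambda>s. f ((p + h *\<^sub>R w) + s *\<^sub>R v) - f (p + s *\<^sub>R v))"
  have "(\<phi> has_real_derivative ?g ((p + h *\<^sub>R w) + s *\<^sub>R v) - ?g (p + s *\<^sub>R v)) (at s)" for s
    unfolding \<phi>_def by (intro DERIV_diff df)
  then obtain s where s: "0 < s" "s < h"
    "\<phi> h - \<phi> 0 = (h - 0) * (?g ((p + h *\<^sub>R w) + s *\<^sub>R v) - ?g (p + s *\<^sub>R v))"
    using MVT2[OF h, of \<phi> "\<lambda>s. ?g ((p + h *\<^sub>R w) + s *\<^sub>R v) - ?g (p + s *\<^sub>R v)"] by blast
  obtain t where t: "0 < t" "t < h"
    "?g ((p + s *\<^sub>R v) + h *\<^sub>R w) - ?g ((p + s *\<^sub>R v) + 0 *\<^sub>R w)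
      = (h - 0) * frechet_derivative ?g (at ((p + s *\<^sub>R v) + t *\<^sub>R w)) w"
    using MVT2[OF h, of "\<lambda>t. ?g ((p + s *\<^sub>R v) + t *\<^sub>R w)"
        "\<lambda>t. frechet_derivative ?g (at ((p + s *\<^sub>R v) + t *\<^sub>R w)) w"] dg by blast
  show ?thesis
  proof (rule that[OF s(1,2) t(1,2)])
    have "f (p + h *\<^sub>R v + h *\<^sub>R w) - f (p + h *\<^sub>R v) - f (p + h *\<^sub>R w) + f p = \<phi> h - \<phi> 0"
      by (simp add: \<phi>_def add_ac)
    also have "\<dots> = h * (h * frechet_derivative ?g (at ((p + s *\<^sub>R v) + t *\<^sub>R w)) w)"
      using s(3) t(3) by (simp add: add_ac)
    finally show "f (p + h *\<^sub>R v + h *\<^sub>R w) - f (p + h *\<^sub>R v) - f (p + h *\<^sub>R w) + f p =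
      h * h * frechet_derivative ?g (at (p + s *\<^sub>R v + t *\<^sub>R w)) w" by simp
  qed
qed

text \<open>The second difference is symmetric in \<open>v\<close> and \<open>w\<close>. Expressing
  it in both orders through mixed derivatives at nearby points and letting the size
  \<open>h n\<close> tend to 0, continuity identifies the two derivatives at
  \<open>p\<close>.\<close>

lemma second_derivative_symmetric_real:
  fixes f :: "'a::real_normed_vector \<Rightarrow> real"
  assumes "smooth f"
  shows "frechet_derivative (\<lambda>q. frechet_derivative f (at q) v) (at p) w =
    frechet_derivative (\<lambda>q. frechet_derivative f (at q) w) (at p) v" (is "?F p = ?G p")
proof -
  have cont: "isCont ?F p" "isCont ?G p"
    using smooth_continuous_on[OF smooth_deriv[OF smooth_deriv[OF assms]]]
    by (auto simp: continuous_on_eq_continuous_at)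
  define h :: "nat \<Rightarrow> real" where "h n = 1 / real (Suc n)" for n
  have h0: "h n > 0" for n by (simp add: h_def)
  have hlim: "h \<longlonglongrightarrow> 0" unfolding h_def by (rule LIMSEQ_Suc[OF lim_1_over_n])
  have "\<exists>s t. 0 < s \<and> s < h n \<and> 0 < t \<and> t < h n \<and>
      f (p + h n *\<^sub>R v + h n *\<^sub>R w) - f (p + h n *\<^sub>R v) - f (p + h n *\<^sub>R w) + f p =
      h n * h n * ?F (p + s *\<^sub>R v + t *\<^sub>R w)" for n
    using double_mean_value[OF assms h0[of n], of p v w] by metis
  then obtain s t where st: "\<And>n. 0 < s n \<and> s n < h n \<and> 0 < t n \<and> t n < h n \<and>
      f (p + h n *\<^sub>R v + h n *\<^sub>R w) - f (p + h n *\<^sub>R v) - f (p + h n *\<^sub>R w) + f p =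
      h n * h n * ?F (p + s n *\<^sub>R v + t n *\<^sub>R w)" by metis
  have "\<exists>s t. 0 < s \<and> s < h n \<and> 0 < t \<and> t < h n \<and>
      f (p + h n *\<^sub>R w + h n *\<^sub>R v) - f (p + h n *\<^sub>R w) - f (p + h n *\<^sub>R v) + f p =
      h n * h n * ?G (p + s *\<^sub>R w + t *\<^sub>R v)" for n
    using double_mean_value[OF assms h0[of n], of p w v] by metis
  then obtain s' t' where st': "\<And>n. 0 < s' n \<and> s' n < h n \<and> 0 < t' n \<and> t' n < h n \<and>
      f (p + h n *\<^sub>R w + h n *\<^sub>R v) - f (p + h n *\<^sub>R w) - f (p + h n *\<^sub>R v) + f p =
      h n * h n * ?G (p + s' n *\<^sub>R w + t' n *\<^sub>R v)" by metis
  have null: "a \<longlonglongrightarrow> 0" if "\<And>n. 0 < a n \<and> a n < h n" for a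
    using that by (intro tendsto_sandwich[OF _ _ tendsto_const hlim]) (auto intro!: always_eventually less_imp_le)
  have lims: "s \<longlonglongrightarrow> 0" "t \<longlonglongrightarrow> 0" "s' \<longlonglongrightarrow> 0" "t' \<longlonglongrightarrow> 0"
    using st st' by (auto intro!: null)
  have "(\<lambda>n. p + s n *\<^sub>R v + t n *\<^sub>R w) \<longlonglongrightarrow> p + 0 *\<^sub>R v + 0 *\<^sub>R w"
    by (intro tendsto_intros lims)
  then have 1: "(\<lambda>n. ?F (p + s n *\<^sub>R v + t n *\<^sub>R w)) \<longlonglongrightarrow> ?F p"
    using isCont_tendsto_compose[OF cont(1)] by simp
  have "(\<lambda>n. p + s' n *\<^sub>R w + t' n *\<^sub>R v) \<longlonglongrightarrow> p + 0 *\<^sub>R w + 0 *\<^sub>R v"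
    by (intro tendsto_intros lims)
  then have 2: "(\<lambda>n. ?G (p + s' n *\<^sub>R w + t' n *\<^sub>R v)) \<longlonglongrightarrow> ?G p"
    using isCont_tendsto_compose[OF cont(2)] by simp
  have "?F (p + s n *\<^sub>R v + t n *\<^sub>R w) = ?G (p + s' n *\<^sub>R w + t' n *\<^sub>R v)" for n
  proof -
    have "h n * h n * ?F (p + s n *\<^sub>R v + t n *\<^sub>R w) = h n * h n * ?G (p + s' n *\<^sub>R w + t' n *\<^sub>R v)"
      using st[of n] st'[of n] unfolding add.assoc add.commute[of "h n *\<^sub>R w" "h n *\<^sub>R v"] by linarith
    then show ?thesis using h0[of n] by simp
  qed
  with 1 2 show ?thesis using LIMSEQ_unique by auto
qed

lemma second_derivative_symmetric:
  fixes f :: "'a::real_normed_vector \<Rightarrow> 'b::euclidean_space"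
  assumes "smooth f"
  shows "frechet_derivative (\<lambda>q. frechet_derivative f (at q) v) (at p) w =
    frechet_derivative (\<lambda>q. frechet_derivative f (at q) w) (at p) v"
proof (rule euclidean_eqI)
  fix b :: 'b
  have comp: "frechet_derivative (\<lambda>q. g q \<bullet> b) (at p) = (\<lambda>v. frechet_derivative g (at p) v \<bullet> b)"
    if "smooth g" for g :: "'a \<Rightarrow> 'b" and p
    using frechet_derivative_comp_linear(1)[OF that bounded_linear_ident bounded_linear_inner_left[of b]] by simp
  have "smooth (\<lambda>q. f q \<bullet> b)"
    using smooth_comp_linear[OF assms bounded_linear_ident bounded_linear_inner_left[of b]] by simp
  from second_derivative_symmetric_real[OF this, of v p w]
  show "frechet_derivative (\<lambda>q. frechet_derivative f (at q) v) (at p) w \<bullet> b =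
    frechet_derivative (\<lambda>q. frechet_derivative f (at q) w) (at p) v \<bullet> b"
    by (simp add: comp assms smooth_deriv)
qed

lemma linear_second_derivative:
  assumes "smooth f"
  shows "linear (\<lambda>w. frechet_derivative (\<lambda>q. frechet_derivative f (at q) w) (at p) v)"
proof (rule linearI)
  fix a b
  have D: "((\<lambda>q. frechet_derivative f (at q) (a + b)) has_derivative
    (\<lambda>v. frechet_derivative (\<lambda>q. frechet_derivative f (at q) a) (at p) v
       + frechet_derivative (\<lambda>q. frechet_derivative f (at q) b) (at p) v)) (at p)"
    unfolding linear_add[OF linear_frechet_derivative_smooth[OF assms]]
    by (intro has_derivative_add smooth_has_derivative smooth_deriv assms)
  show "frechet_derivative (\<lambda>q. frechet_derivative f (at q) (a + b)) (at p) v =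
      frechet_derivative (\<lambda>q. frechet_derivative f (at q) a) (at p) v
       + frechet_derivative (\<lambda>q. frechet_derivative f (at q) b) (at p) v"
    unfolding frechet_derivative_at[OF D, symmetric] ..
next
  fix r a
  have D: "((\<lambda>q. frechet_derivative f (at q) (r *\<^sub>R a)) has_derivative
    (\<lambda>v. r *\<^sub>R frechet_derivative (\<lambda>q. frechet_derivative f (at q) a) (at p) v)) (at p)"
    unfolding linear_scale[OF linear_frechet_derivative_smooth[OF assms]]
    by (intro has_derivative_scaleR_right smooth_has_derivative smooth_deriv assms)
  show "frechet_derivative (\<lambda>q. frechet_derivative f (at q) (r *\<^sub>R a)) (at p) v =
      r *\<^sub>R frechet_derivative (\<lambda>q. frechet_derivative f (at q) a) (at p) v"
    unfolding frechet_derivative_at[OF D, symmetric] ..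
qed

text \<open>Smoothness speaks of derivatives in a fixed direction, whereas here the direction
  \<open>Y q\<close> moves with the point. Expanding \<open>Y q\<close> in the basis reduces the
  claim to the product rule for each summand; linearity in the direction then reassembles the
  sums.\<close>

lemma has_derivative_along_field:
  fixes Y :: "'c::euclidean_space \<Rightarrow> 'c" and Z :: "'c \<Rightarrow> 'd::real_normed_vector"
  assumes "smooth Y" "smooth Z"
  shows "((\<lambda>q. frechet_derivative Z (at q) (Y q)) has_derivative
    (\<lambda>v. frechet_derivative (\<lambda>q. frechet_derivative Z (at q) (Y p)) (at p) v
       + frechet_derivative Z (at p) (frechet_derivative Y (at p) v))) (at p)"
proof -
  have expand: "L a = (\<Sum>b\<in>Basis. (a \<bullet> b) *\<^sub>R L b)" if "linear L" for L :: "'c \<Rightarrow> 'd" and a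
  proof -
    have "L a = L (\<Sum>b\<in>Basis. (a \<bullet> b) *\<^sub>R b)" by (simp add: euclidean_representation)
    then show ?thesis by (simp add: linear_sum[OF that] linear_scale[OF that])
  qed
  have "((\<lambda>q. \<Sum>b\<in>Basis. (Y q \<bullet> b) *\<^sub>R frechet_derivative Z (at q) b) has_derivative
    (\<lambda>v. \<Sum>b\<in>Basis. (Y p \<bullet> b) *\<^sub>R frechet_derivative (\<lambda>q. frechet_derivative Z (at q) b) (at p) v
        + (frechet_derivative Y (at p) v \<bullet> b) *\<^sub>R frechet_derivative Z (at p) b)) (at p)"
    by (intro has_derivative_sum has_derivative_scaleR has_derivative_inner_left
        smooth_has_derivative smooth_deriv assms)
  moreover have "(\<lambda>q. \<Sum>b\<in>Basis. (Y q \<bullet> b) *\<^sub>R frechet_derivative Z (at q) b) =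
      (\<lambda>q. frechet_derivative Z (at q) (Y q))"
    by (intro ext expand[symmetric] linear_frechet_derivative_smooth assms)
  moreover have "(\<lambda>v. \<Sum>b\<in>Basis. (Y p \<bullet> b) *\<^sub>R frechet_derivative (\<lambda>q. frechet_derivative Z (at q) b) (at p) v
        + (frechet_derivative Y (at p) v \<bullet> b) *\<^sub>R frechet_derivative Z (at p) b) =
    (\<lambda>v. frechet_derivative (\<lambda>q. frechet_derivative Z (at q) (Y p)) (at p) v
       + frechet_derivative Z (at p) (frechet_derivative Y (at p) v))"
    unfolding sum.distrib
    by (intro ext arg_cong2[where f = "(+)"] expand[symmetric] linear_second_derivative
        linear_frechet_derivative_smooth assms)
  ultimately show ?thesis by simp
qed

section \<open>Reduction of curvature and of the Killing equation to algebra in one tangent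
  space\<close>

section \<open>Constant connections and Killing fields\<close>

text \<open>The product \<open>B\<close> of the overview.\<close>

definition christoffel ::
  "('n::finite \<Rightarrow> 'n \<Rightarrow> 'n \<Rightarrow> real) \<Rightarrow> real^'n \<Rightarrow> real^'n \<Rightarrow> real^'n" where
  "christoffel \<Gamma> v w = (\<chi> k. \<Sum>i\<in>UNIV. \<Sum>j\<in>UNIV. v $ i * w $ j * \<Gamma> i j k)"

text \<open>The curvature tensor at a point. As the symbols are constant, only the commutator of two
  left multiplications survives; see \<open>curvature_eq\<close>.\<close>

definition riem ::
  "('n::finite \<Rightarrow> 'n \<Rightarrow> 'n \<Rightarrow> real) \<Rightarrow> real^'n \<Rightarrow> real^'n \<Rightarrow> real^'n \<Rightarrow> real^'n" where
  "riem \<Gamma> u v w = christoffel \<Gamma> u (christoffel \<Gamma> v w) - christoffel \<Gamma> v (christoffel \<Gamma> u w)"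

definition ric :: "('n::finite \<Rightarrow> 'n \<Rightarrow> 'n \<Rightarrow> real) \<Rightarrow> real^'n \<Rightarrow> real^'n \<Rightarrow> real" where
  "ric \<Gamma> v w = trace (matrix (\<lambda>z. riem \<Gamma> z v w))"

lemma bounded_bilinear_christoffel: "bounded_bilinear (christoffel \<Gamma>)"
  unfolding bilinear_conv_bounded_bilinear[symmetric] bilinear_def christoffel_def
  by (auto intro!: linearI simp: vec_eq_iff algebra_simps sum.distrib sum_distrib_left)

interpretation christoffel: bounded_bilinear "christoffel \<Gamma>" for \<Gamma>
  by (rule bounded_bilinear_christoffel)

lemma christoffel_sym:
  assumes "\<And>i j k. \<Gamma> i j k = \<Gamma> j i k"
  shows "christoffel \<Gamma> v w = christoffel \<Gamma> w v"
  unfolding christoffel_def vec_eq_iff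
  by (subst sum.swap) (simp add: assms mult.commute mult.left_commute)

lemma cov_eq: "cov \<Gamma> Y Z = (\<lambda>p. frechet_derivative Z (at p) (Y p) + christoffel \<Gamma> (Y p) (Z p))"
  unfolding cov_def christoffel_def ..

lemma bounded_bilinear_ric: "bounded_bilinear (ric \<Gamma>)"
  unfolding bilinear_conv_bounded_bilinear[symmetric] bilinear_def ric_def trace_def matrix_def riem_def
  by (auto intro!: linearI simp: christoffel.add_left christoffel.add_right
      christoffel.scaleR_left christoffel.scaleR_right algebra_simps sum.distrib sum_distrib_left
      sum_subtractf)

interpretation ric: bounded_bilinear "ric \<Gamma>" for \<Gamma>
  by (rule bounded_bilinear_ric)

lemma linear_riem: "linear (\<lambda>z. riem \<Gamma> z v w)"
  unfolding riem_def
  by (auto intro!: linearI simp: christoffel.add_left christoffel.add_right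
      christoffel.scaleR_left christoffel.scaleR_right algebra_simps)

lemma has_derivative_cov:
  assumes "smooth Y" "smooth Z"
  shows "(cov \<Gamma> Y Z has_derivative
    (\<lambda>v. frechet_derivative (\<lambda>q. frechet_derivative Z (at q) (Y p)) (at p) v
       + frechet_derivative Z (at p) (frechet_derivative Y (at p) v)
       + (christoffel \<Gamma> (Y p) (frechet_derivative Z (at p) v)
         + christoffel \<Gamma> (frechet_derivative Y (at p) v) (Z p)))) (at p)"
  unfolding cov_eq
  by (intro has_derivative_add has_derivative_along_field christoffel.FDERIV
      smooth_has_derivative assms)

lemma has_derivative_lie_bracket:
  assumes "smooth X" "smooth Y"
  shows "(lie_bracket X Y has_derivative
    (\<lambda>v. (frechet_derivative (\<lambda>q. frechet_derivative Y (at q) (X p)) (at p) v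
       + frechet_derivative Y (at p) (frechet_derivative X (at p) v))
     - (frechet_derivative (\<lambda>q. frechet_derivative X (at q) (Y p)) (at p) v
       + frechet_derivative X (at p) (frechet_derivative Y (at p) v)))) (at p)"
  unfolding lie_bracket_def
  by (intro has_derivative_diff has_derivative_along_field assms)

text \<open>Tensoriality: the second derivatives of \<open>Z\<close> cancel by symmetry, the first
  derivatives of \<open>X\<close> and \<open>Y\<close> cancel against the bracket term, and the
  first derivatives of \<open>Z\<close> cancel between the two iterated covariant
  derivatives.\<close>

lemma curvature_eq:
  assumes "smooth X" "smooth Y" "smooth Z"
  shows "curvature \<Gamma> X Y Z p = riem \<Gamma> (X p) (Y p) (Z p)"
proof -
  note lin = linear_frechet_derivative_smooth[OF assms(3)]
  show ?thesis
    unfolding curvature_def fun_diff_def cov_eq[of _ X "cov \<Gamma> Y Z"] cov_eq[of _ Y "cov \<Gamma> X Z"]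
      cov_eq[of _ "lie_bracket X Y" Z]
      frechet_derivative_at[OF has_derivative_cov[OF assms(2,3)], symmetric]
      frechet_derivative_at[OF has_derivative_cov[OF assms(1,3)], symmetric]
      second_derivative_symmetric[OF assms(3), of "Y p"]
    by (simp add: cov_eq lie_bracket_def riem_def linear_diff[OF lin]
        christoffel.diff_left christoffel.add_right)
qed

text \<open>Not the trace form of a Lie algebra: this measures how far \<open>L\<close> is from
  being a derivation of the product \<open>christoffel \<Gamma>\<close>.\<close>

definition killing_form ::
  "('n::finite \<Rightarrow> 'n \<Rightarrow> 'n \<Rightarrow> real) \<Rightarrow> (real^'n \<Rightarrow> real^'n) \<Rightarrow> real^'n \<Rightarrow> real^'n \<Rightarrow> real^'n" where
  "killing_form \<Gamma> L v w =
    L (christoffel \<Gamma> v w) - christoffel \<Gamma> (L v) w - christoffel \<Gamma> v (L w)"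

text \<open>The Lie derivative of a connection is a tensor: all derivatives of \<open>Y\<close> and
  \<open>Z\<close> cancel, the second derivatives of \<open>Z\<close> by symmetry. What remains
  contains only the first two derivatives of \<open>X\<close>.\<close>

lemma killing_defect:
  assumes "smooth X" "smooth Y" "smooth Z"
  shows "(lie_bracket X (cov \<Gamma> Y Z) - cov \<Gamma> Y (lie_bracket X Z) - cov \<Gamma> (lie_bracket X Y) Z) p =
    frechet_derivative (\<lambda>q. frechet_derivative X (at q) (Z p)) (at p) (Y p)
     - killing_form \<Gamma> (frechet_derivative X (at p)) (Y p) (Z p)"
proof -
  note lin = linear_frechet_derivative_smooth[OF assms(1)] linear_frechet_derivative_smooth[OF assms(3)]
  show ?thesis
    unfolding fun_diff_def cov_eq[of _ Y "lie_bracket X Z"] cov_eq[of _ "lie_bracket X Y" Z]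
      lie_bracket_def[of X "cov \<Gamma> Y Z"] killing_form_def
      frechet_derivative_at[OF has_derivative_cov[OF assms(2,3)], symmetric]
      frechet_derivative_at[OF has_derivative_lie_bracket[OF assms(1,3)], symmetric]
      second_derivative_symmetric[OF assms(3), of "Y p"]
    by (simp add: cov_eq lie_bracket_def linear_diff[OF lin(1)] linear_add[OF lin(1)]
        linear_diff[OF lin(2)] christoffel.diff_left christoffel.diff_right)
qed

text \<open>By \<open>killing_defect\<close> only the values of \<open>Y\<close> and
  \<open>Z\<close> at \<open>p\<close> matter, so constant fields suffice as test fields.\<close>

lemma killing_iff:
  "X \<in> killing \<Gamma> \<longleftrightarrow> smooth X \<and>
    (\<forall>p v w. frechet_derivative (\<lambda>q. frechet_derivative X (at q) w) (at p) v
       = killing_form \<Gamma> (frechet_derivative X (at p)) v w)" (is "_ \<longleftrightarrow> _ \<and> ?E")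
proof (cases "smooth X")
  case True
  have "X \<in> killing \<Gamma> \<longleftrightarrow> (\<forall>Y Z. smooth Y \<longrightarrow> smooth Z \<longrightarrow>
      (\<forall>p. frechet_derivative (\<lambda>q. frechet_derivative X (at q) (Z p)) (at p) (Y p)
       = killing_form \<Gamma> (frechet_derivative X (at p)) (Y p) (Z p)))"
    using True by (auto simp: killing_def fun_eq_iff killing_defect simp del: minus_apply)
  also have "\<dots> \<longleftrightarrow> ?E"
  proof (intro iffI allI impI)
    fix p v w
    assume "\<forall>Y Z. smooth Y \<longrightarrow> smooth Z \<longrightarrow>
      (\<forall>p. frechet_derivative (\<lambda>q. frechet_derivative X (at q) (Z p)) (at p) (Y p)
       = killing_form \<Gamma> (frechet_derivative X (at p)) (Y p) (Z p))"
    from this[rule_format, of "\<lambda>_. v" "\<lambda>_. w" p]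
    show "frechet_derivative (\<lambda>q. frechet_derivative X (at q) w) (at p) v
       = killing_form \<Gamma> (frechet_derivative X (at p)) v w" by simp
  qed auto
  finally show ?thesis using True by simp
qed (simp add: killing_def)

lemma killing_const: "(\<lambda>_. c) \<in> killing \<Gamma>"
  by (simp add: killing_iff killing_form_def christoffel.zero_left christoffel.zero_right)

text \<open>Integrability condition of the Killing equation. The equation is differentiated once
  more and its right-hand side is used again for the derivative of \<open>L\<close>; equating the
  third derivatives in the directions \<open>u, v\<close> and \<open>v, u\<close> leaves exactly the
  derivation property of \<open>L p\<close> on the curvature.\<close>

lemma killing_riem:
  assumes X: "X \<in> killing \<Gamma>" and sym: "\<And>i j k. \<Gamma> i j k = \<Gamma> j i k"
  defines "L p \<equiv> frechet_derivative X (at p)"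
  shows "L p (riem \<Gamma> u v w) = riem \<Gamma> (L p u) v w + riem \<Gamma> u (L p v) w + riem \<Gamma> u v (L p w)"
proof -
  from X have "smooth X" by (simp add: killing_iff)
  have lin: "linear (L p)"
    unfolding L_def by (rule linear_frechet_derivative_smooth) fact
  have second: "frechet_derivative (\<lambda>q. L q b) (at p) = (\<lambda>a. killing_form \<Gamma> (L p) a b)" for b p
    using X by (simp add: killing_iff L_def fun_eq_iff)
  have "((\<lambda>q. L q b) has_derivative frechet_derivative (\<lambda>q. L q b) (at p)) (at p)" for b p
    unfolding L_def by (intro smooth_has_derivative smooth_deriv) fact
  then have dL: "((\<lambda>q. L q b) has_derivative (\<lambda>a. killing_form \<Gamma> (L p) a b)) (at p)" for b p
    by (simp add: second)
  have expand: "(\<lambda>q. killing_form \<Gamma> (L q) a w) = (\<lambda>q. L q (christoffel \<Gamma> a w)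
      - christoffel \<Gamma> (L q a) w - christoffel \<Gamma> a (L q w))" for a
    by (simp add: killing_form_def)
  \<comment> \<open>\<open>killing_form\<close> is linear in its endomorphism, so differentiating in
    direction \<open>c\<close> replaces each \<open>L q b\<close> by
    \<open>killing_form \<Gamma> (L p) c b\<close>.\<close>
  have "((\<lambda>q. killing_form \<Gamma> (L q) a w) has_derivative
      (\<lambda>c. killing_form \<Gamma> (L p) c (christoffel \<Gamma> a w)
        - christoffel \<Gamma> (killing_form \<Gamma> (L p) c a) w
        - christoffel \<Gamma> a (killing_form \<Gamma> (L p) c w))) (at p)" for a
    unfolding expand
    by (intro has_derivative_diff dL
        bounded_linear.has_derivative[OF christoffel.bounded_linear_left]
        bounded_linear.has_derivative[OF christoffel.bounded_linear_right])
  from frechet_derivative_at[OF this, symmetric]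
  have third: "frechet_derivative (\<lambda>q. frechet_derivative (\<lambda>q. L q w) (at q) a) (at p) c =
      killing_form \<Gamma> (L p) c (christoffel \<Gamma> a w)
        - christoffel \<Gamma> (killing_form \<Gamma> (L p) c a) w
        - christoffel \<Gamma> a (killing_form \<Gamma> (L p) c w)" for a c
    by (simp add: second)
  have "smooth (\<lambda>q. L q w)" unfolding L_def by (rule smooth_deriv) fact
  from second_derivative_symmetric[OF this, of v p u]
  show ?thesis
    unfolding third
    by (simp add: killing_form_def riem_def linear_diff[OF lin]
        christoffel.diff_left christoffel.diff_right christoffel.add_right christoffel_sym[of \<Gamma> u v, OF sym]
        christoffel_sym[of \<Gamma> u "L p v", OF sym] christoffel_sym[of \<Gamma> "L p u" v, OF sym]
       algebra_simps)
qed

text \<open>Taking the trace over the first slot in \<open>killing_riem\<close> leaves the trace of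
  the commutator of \<open>L\<close> with \<open>?R\<close>, which is zero.\<close>

lemma killing_ric:
  assumes X: "X \<in> killing \<Gamma>" and sym: "\<And>i j k. \<Gamma> i j k = \<Gamma> j i k"
  shows "ric \<Gamma> (frechet_derivative X (at p) v) w + ric \<Gamma> v (frechet_derivative X (at p) w) = 0"
proof -
  define L where "L = frechet_derivative X (at p)"
  from X have "smooth X" by (simp add: killing_iff)
  then have lin: "linear L" unfolding L_def by (rule linear_frechet_derivative_smooth)
  let ?R = "\<lambda>z. riem \<Gamma> z v w"
  have "ric \<Gamma> (L v) w + ric \<Gamma> v (L w) = (\<Sum>i\<in>UNIV. (riem \<Gamma> (axis i 1) (L v) w + riem \<Gamma> (axis i 1) v (L w)) $ i)"
    by (simp add: ric_def trace_def matrix_def sum.distrib)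
  also have "\<dots> = (\<Sum>i\<in>UNIV. (L (?R (axis i 1)) - ?R (L (axis i 1))) $ i)"
    using killing_riem[OF X sym, of p _ v w] by (simp add: L_def add_ac)
  also have "\<dots> = trace (matrix (L \<circ> ?R)) - trace (matrix (?R \<circ> L))"
    by (simp add: trace_def matrix_def sum_subtractf)
  also have "\<dots> = 0"
    unfolding matrix_compose[OF linear_riem lin] matrix_compose[OF lin linear_riem]
    by (simp add: trace_mul_sym[of "matrix L"])
  finally show ?thesis by (simp add: L_def)
qed

lemma ricci_coord_field:
  "ricci \<Gamma> (coord_field i) (coord_field j) p = ric \<Gamma> (axis i 1) (axis j 1)"
proof -
  have "curvature \<Gamma> (\<lambda>_. w) (coord_field i) (coord_field j) p = riem \<Gamma> w (axis i 1) (axis j 1)" for w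
    by (simp add: curvature_eq) (simp add: coord_field_def)
  then show ?thesis by (simp add: ricci_def ric_def)
qed

lemma ricci_matrix_nth: "ricci_matrix \<Gamma> p $ i $ j = ric \<Gamma> (axis i 1) (axis j 1)"
  by (simp add: ricci_matrix_def ricci_coord_field)

section \<open>Rigidity: a nondegenerate Ricci form admits only constant Killing fields\<close>

section \<open>Surfaces with nondegenerate Ricci form\<close>

lemma christoffel_2:
  fixes \<Gamma> :: "2 \<Rightarrow> 2 \<Rightarrow> 2 \<Rightarrow> real"
  shows "christoffel \<Gamma> v w $ k = v $ 1 * w $ 1 * \<Gamma> 1 1 k + v $ 1 * w $ 2 * \<Gamma> 1 2 k
    + v $ 2 * w $ 1 * \<Gamma> 2 1 k + v $ 2 * w $ 2 * \<Gamma> 2 2 k"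
  by (simp add: christoffel_def sum_2)

lemma ric_2:
  fixes \<Gamma> :: "2 \<Rightarrow> 2 \<Rightarrow> 2 \<Rightarrow> real"
  assumes "\<And>i j k. \<Gamma> i j k = \<Gamma> j i k"
  shows "ric \<Gamma> v w =
    v $ 1 * w $ 1 * (\<Gamma> 1 2 2 * (\<Gamma> 1 1 1 - \<Gamma> 1 2 2) + \<Gamma> 1 1 2 * (\<Gamma> 2 2 2 - \<Gamma> 1 2 1))
    + (v $ 1 * w $ 2 + v $ 2 * w $ 1) * (\<Gamma> 1 2 1 * \<Gamma> 1 2 2 - \<Gamma> 1 1 2 * \<Gamma> 2 2 1)
    + v $ 2 * w $ 2 * (\<Gamma> 1 2 1 * (\<Gamma> 2 2 2 - \<Gamma> 1 2 1) + \<Gamma> 2 2 1 * (\<Gamma> 1 1 1 - \<Gamma> 1 2 2))"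
  by (simp add: ric_def trace_def matrix_def sum_2 riem_def christoffel_2 assms[of 2 1] axis_def
      algebra_simps)

lemma ric_sym:
  fixes \<Gamma> :: "2 \<Rightarrow> 2 \<Rightarrow> 2 \<Rightarrow> real"
  assumes "\<And>i j k. \<Gamma> i j k = \<Gamma> j i k"
  shows "ric \<Gamma> v w = ric \<Gamma> w v"
  unfolding ric_2[OF assms] by (simp add: algebra_simps)

text \<open>Skewness in \<open>u\<close> and \<open>v\<close> makes the curvature of a surface the
  area form times the operator given by axes 1 and 2, and the two components of that operator are
  Ricci values. Hence a vanishing Ricci form means flatness.\<close>

lemma riem_eq_ric:
  fixes \<Gamma> :: "2 \<Rightarrow> 2 \<Rightarrow> 2 \<Rightarrow> real"
  assumes "\<And>i j k. \<Gamma> i j k = \<Gamma> j i k"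
  shows "riem \<Gamma> u v w = (u $ 1 * v $ 2 - u $ 2 * v $ 1) *\<^sub>R
    vector [ric \<Gamma> (axis 2 1) w, - ric \<Gamma> (axis 1 1) w]"
  unfolding ric_2[OF assms]
  by (simp add: vec_eq_iff forall_2 riem_def christoffel_2 assms[of 2 1] axis_def algebra_simps)

lemma ric_neq_0:
  fixes \<Gamma> :: "2 \<Rightarrow> 2 \<Rightarrow> 2 \<Rightarrow> real"
  assumes sym: "\<And>i j k. \<Gamma> i j k = \<Gamma> j i k" and "\<not> flat \<Gamma>"
  obtains v w where "ric \<Gamma> v w \<noteq> 0"
proof -
  obtain X Y Z p where "smooth X" "smooth Y" "smooth Z" "curvature \<Gamma> X Y Z p \<noteq> 0"
    using \<open>\<not> flat \<Gamma>\<close> by (auto simp: flat_def fun_eq_iff)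
  then have "vector [ric \<Gamma> (axis 2 1) (Z p), - ric \<Gamma> (axis 1 1) (Z p)] \<noteq> (0 :: real^2)"
    by (auto simp: curvature_eq riem_eq_ric[OF sym])
  then show ?thesis using that by (auto simp: vec_eq_iff forall_2)
qed

lemma vec2_expand: "v = v $ 1 *\<^sub>R axis 1 1 + v $ 2 *\<^sub>R axis 2 (1::real)" for v :: "real^2"
  by (simp add: vec_eq_iff forall_2 axis_def)

lemma ricci_matrix_mult:
  fixes \<Gamma> :: "2 \<Rightarrow> 2 \<Rightarrow> 2 \<Rightarrow> real"
  shows "(ricci_matrix \<Gamma> p *v w) $ i = ric \<Gamma> (axis i 1) w"
  by (subst (2) vec2_expand[of w])
    (simp add: matrix_vector_mult_def sum_2 ricci_matrix_nth ric.add_right ric.scaleR_right)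

definition ric_nondegenerate :: "('n::finite \<Rightarrow> 'n \<Rightarrow> 'n \<Rightarrow> real) \<Rightarrow> bool" where
  "ric_nondegenerate \<Gamma> \<longleftrightarrow> (\<forall>w. (\<forall>v. ric \<Gamma> v w = 0) \<longrightarrow> w = 0)"

text \<open>Non-flatness excludes rank 0 by \<open>ric_neq_0\<close>, and full rank of a square
  matrix is injectivity, that is nondegeneracy of the form. Only rank 1 is left for the degenerate
  case.\<close>

lemma rank_ricci_matrix:
  fixes \<Gamma> :: "2 \<Rightarrow> 2 \<Rightarrow> 2 \<Rightarrow> real"
  assumes sym: "\<And>i j k. \<Gamma> i j k = \<Gamma> j i k" and "\<not> flat \<Gamma>"
  shows "rank (ricci_matrix \<Gamma> p) = (if ric_nondegenerate \<Gamma> then 2 else 1)"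
proof -
  let ?M = "ricci_matrix \<Gamma> p"
  have ker: "?M *v w = 0 \<longleftrightarrow> (\<forall>v. ric \<Gamma> v w = 0)" for w
  proof
    assume "?M *v w = 0"
    then have "ric \<Gamma> (axis i 1) w = 0" for i
      by (metis ricci_matrix_mult zero_index)
    then show "\<forall>v. ric \<Gamma> v w = 0"
      by (metis vec2_expand ric.add_left ric.scaleR_left scaleR_zero_right add_0)
  qed (simp add: vec_eq_iff ricci_matrix_mult)
  obtain v w where "ric \<Gamma> v w \<noteq> 0" using ric_neq_0[OF assms] .
  then have "?M \<noteq> 0" using ker[of w] by auto
  then have "rank ?M \<noteq> 0" by (simp add: rank_eq_0)
  moreover have "rank ?M \<le> 2" using rank_bound[of ?M] by simp
  moreover have "rank ?M = 2 \<longleftrightarrow> ric_nondegenerate \<Gamma>"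
    using full_rank_injective[of ?M] linear_injective_0[OF matrix_vector_mul_linear[of ?M]]
    by (simp add: ric_nondegenerate_def ker)
  ultimately show ?thesis by auto
qed

text \<open>Skewness in the last two arguments followed by symmetry in the first two rotates
  \<open>u, v, w\<close> cyclically at the cost of a sign; three rotations return the original
  expression with a minus sign. The same argument proves uniqueness of the Levi-Civita
  connection.\<close>

lemma skew_invariant_form_zero:
  fixes Q :: "'a \<Rightarrow> 'a \<Rightarrow> 'a" and g :: "'a \<Rightarrow> 'a \<Rightarrow> real"
  assumes "\<And>u v. Q u v = Q v u" and "\<And>u v. g u v = g v u"
    and "\<And>u v w. g (Q u v) w + g v (Q u w) = 0"
  shows "g (Q u v) w = 0"
proof -
  have skew: "g (Q u v) w = - g (Q u w) v" for u v w
    using assms(3)[of u v w] assms(2)[of v] by simp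
  have "g (Q u v) w = - g (Q w u) v" using skew[of u v w] assms(1)[of u w] by simp
  also have "\<dots> = g (Q v w) u" using skew[of w u v] assms(1)[of w v] by simp
  also have "\<dots> = - g (Q u v) w" using skew[of v w u] assms(1)[of v u] by simp
  finally show ?thesis by simp
qed

text \<open>A skew endomorphism \<open>L\<close> of a nondegenerate plane has trace 0, so \<open>L\<^sup>2 = \<mu>\<close> is scalar. If \<open>L\<close>
  acts on a bilinear product as a derivation, then \<open>B (L v) (L w) = - \<mu> / 2 * B v w\<close>; applying this
  twice gives \<open>\<mu>\<^sup>2 = \<mu>\<^sup>2 / 4\<close> unless \<open>B = 0\<close>.\<close>

lemma skew_derivation_zero:
  fixes \<Gamma> :: "2 \<Rightarrow> 2 \<Rightarrow> 2 \<Rightarrow> real"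
  assumes sym: "\<And>i j k. \<Gamma> i j k = \<Gamma> j i k" and nondeg: "ric_nondegenerate \<Gamma>"
    and lin: "linear L"
    and skew: "\<And>v w. ric \<Gamma> (L v) w + ric \<Gamma> v (L w) = 0"
    and deriv: "\<And>v w. killing_form \<Gamma> L v w = 0"
  shows "L v = 0"
proof -
  let ?e1 = "axis 1 1 :: real^2" and ?e2 = "axis 2 1 :: real^2"
  define r s t where "r = ric \<Gamma> ?e1 ?e1" and "s = ric \<Gamma> ?e1 ?e2" and "t = ric \<Gamma> ?e2 ?e2"
  define l11 l21 l12 l22 where l: "l11 = L ?e1 $ 1" "l21 = L ?e1 $ 2" "l12 = L ?e2 $ 1" "l22 = L ?e2 $ 2"
  have ric: "ric \<Gamma> v w = r * v $ 1 * w $ 1 + s * (v $ 1 * w $ 2 + v $ 2 * w $ 1) + t * v $ 2 * w $ 2" for v w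
    unfolding r_def s_def t_def ric_2[OF sym] by (simp add: axis_def algebra_simps)
  have L: "L v $ 1 = l11 * v $ 1 + l12 * v $ 2" "L v $ 2 = l21 * v $ 1 + l22 * v $ 2" for v
    by (subst vec2_expand[of v], simp add: linear_add[OF lin] linear_scale[OF lin] l mult.commute)+
  have det: "r * t - s * s \<noteq> 0"
  proof
    assume 0: "r * t - s * s = 0"
    \<comment> \<open>These vectors are, up to sign, the columns of the adjugate of the Gram matrix.
      If the determinant vanishes they lie in the kernel of the form, hence are zero, and then the
      form itself is zero.\<close>
    have "ric \<Gamma> v (vector [s, - r]) = - (r * t - s * s) * v $ 2"
      "ric \<Gamma> v (vector [t, - s]) = (r * t - s * s) * v $ 1" for v
      by (simp_all add: ric algebra_simps)
    then have "vector [s, - r] = (0 :: real^2)" "vector [t, - s] = (0 :: real^2)"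
      using nondeg 0 unfolding ric_nondegenerate_def by auto
    then have "ric \<Gamma> v ?e1 = 0" for v by (auto simp: ric vec_eq_iff forall_2)
    then show False using nondeg unfolding ric_nondegenerate_def
      by (metis axis_eq_0_iff zero_neq_one)
  qed
  have e11: "r * l11 + s * l21 = 0" using skew[of ?e1 ?e1] by (simp add: ric L axis_def algebra_simps)
  have e22: "s * l12 + t * l22 = 0" using skew[of ?e2 ?e2] by (simp add: ric L axis_def algebra_simps)
  have e12: "r * l12 + s * l22 + (s * l11 + t * l21) = 0" using skew[of ?e1 ?e2] by (simp add: ric L axis_def algebra_simps)
  \<comment> \<open>Let G be the Gram matrix with entries \<open>r\<close>, \<open>s\<close>,
    \<open>t\<close>. The three equations say that GL is skew, so L is the product of a symmetric
    and a skew matrix and has trace 0.\<close>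
  have "(r * t - s * s) * (l11 + l22) = 0" using e11 e22 e12 by algebra
  then have tr: "l22 = - l11" using det by simp
  \<comment> \<open>With trace 0 this is minus the determinant of \<open>L\<close>, and the next
    identity is Cayley-Hamilton.\<close>
  define \<mu> where "\<mu> = l11 * l11 + l12 * l21"
  have LL: "L (L v) = \<mu> *\<^sub>R v" for v
    by (simp add: vec_eq_iff forall_2 L tr \<mu>_def algebra_simps)
  let ?B = "christoffel \<Gamma>"
  have D: "L (?B v w) = ?B (L v) w + ?B v (L w)" for v w
    using deriv[of v w] by (simp add: killing_form_def algebra_simps)
  have half: "2 *\<^sub>R ?B (L v) (L w) = - \<mu> *\<^sub>R ?B v w" for v w
  proof -
    have "\<mu> *\<^sub>R ?B v w = L (L (?B v w))" by (simp add: LL)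
    also have "\<dots> = ?B (L (L v)) w + 2 *\<^sub>R ?B (L v) (L w) + ?B v (L (L w))"
      by (simp add: D linear_add[OF lin] scaleR_2)
    finally have eq: "\<mu> *\<^sub>R ?B v w = \<mu> *\<^sub>R ?B v w + 2 *\<^sub>R ?B (L v) (L w) + \<mu> *\<^sub>R ?B v w"
      unfolding LL christoffel.scaleR_left christoffel.scaleR_right .
    show ?thesis unfolding vec_eq_iff
    proof
      fix i
      show "(2 *\<^sub>R ?B (L v) (L w)) $ i = (- \<mu> *\<^sub>R ?B v w) $ i"
        using arg_cong[OF eq, of "\<lambda>x. x $ i"] by simp
    qed
  qed
  have \<mu>B: "(\<mu> * \<mu>) *\<^sub>R ?B v w = 0" for v w
  proof -
    have "((\<mu> * \<mu>) *\<^sub>R ?B v w) $ i = 0" for i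
    proof -
      have "2 * (\<mu> * (\<mu> * ?B v w $ i)) = - \<mu> * ?B (L v) (L w) $ i"
        using arg_cong[OF half[of "L v" "L w"], of "\<lambda>x. x $ i"]
        by (simp add: LL christoffel.scaleR_left christoffel.scaleR_right)
      moreover have "2 * ?B (L v) (L w) $ i = - \<mu> * ?B v w $ i"
        using arg_cong[OF half[of v w], of "\<lambda>x. x $ i"] by simp
      ultimately show ?thesis by simp algebra
    qed
    then show ?thesis by (simp only: vec_eq_iff zero_index) simp
  qed
  have "\<mu> = 0"
  proof (rule ccontr)
    assume "\<mu> \<noteq> 0"
    then have "?B v w = 0" for v w using \<mu>B[of v w] by simp
    then have "ric \<Gamma> v w = 0" for v w by (simp add: ric_def riem_def trace_def matrix_def)
    then show False using nondeg unfolding ric_nondegenerate_def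
      by (metis axis_eq_0_iff zero_neq_one)
  qed
  \<comment> \<open>Multiplicativity of the determinant for GL, a skew matrix whose entries are 0
    and, up to sign, \<open>s * l11 + t * l21\<close>. With \<open>\<mu> = 0\<close> it follows that
    GL vanishes, and so does \<open>L\<close>.\<close>
  have "(r * t - s * s) * - \<mu> = (s * l11 + t * l21)\<^sup>2"
    using e11 e22 e12 unfolding \<mu>_def tr by algebra
  with \<open>\<mu> = 0\<close> have \<lambda>: "s * l11 + t * l21 = 0" by simp
  have "(r * t - s * s) * l11 = 0" "(r * t - s * s) * l21 = 0"
    "(r * t - s * s) * l12 = 0"
    using \<lambda> e11 e12 e22 by algebra+
  then have "l11 = 0" "l21 = 0" "l12 = 0" using det by auto
  then show ?thesis by (simp add: vec_eq_iff forall_2 L tr)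
qed

lemma killing_const_if_nondegenerate:
  fixes \<Gamma> :: "2 \<Rightarrow> 2 \<Rightarrow> 2 \<Rightarrow> real"
  assumes sym: "\<And>i j k. \<Gamma> i j k = \<Gamma> j i k" and nondeg: "ric_nondegenerate \<Gamma>"
    and X: "X \<in> killing \<Gamma>"
  obtains c where "X = (\<lambda>_. c)"
proof -
  from X have "smooth X" by (simp add: killing_iff)
  have second: "frechet_derivative (\<lambda>q. frechet_derivative X (at q) w) (at p) v
       = killing_form \<Gamma> (frechet_derivative X (at p)) v w" for p v w
    using X by (simp add: killing_iff)
  have "frechet_derivative X (at p) v = 0" for p v
  proof (rule skew_derivation_zero[where L = "frechet_derivative X (at p)", OF sym nondeg])
    let ?Q = "killing_form \<Gamma> (frechet_derivative X (at p))"
    \<comment> \<open>Skewness of the derivative of \<open>X\<close> holds at every point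
      \<open>q\<close>, so it may be differentiated in \<open>q\<close>; the Killing equation turns
      the resulting second derivatives into \<open>?Q\<close>.\<close>
    have "((\<lambda>q. ric \<Gamma> (frechet_derivative X (at q) v) w + ric \<Gamma> v (frechet_derivative X (at q) w))
      has_derivative (\<lambda>u. ric \<Gamma> (frechet_derivative (\<lambda>q. frechet_derivative X (at q) v) (at p) u) w
        + ric \<Gamma> v (frechet_derivative (\<lambda>q. frechet_derivative X (at q) w) (at p) u))) (at p)" for v w
      by (intro has_derivative_add bounded_linear.has_derivative[OF ric.bounded_linear_left]
          bounded_linear.has_derivative[OF ric.bounded_linear_right]
          smooth_has_derivative smooth_deriv \<open>smooth X\<close>)
    then have "(\<lambda>u. ric \<Gamma> (?Q u v) w + ric \<Gamma> v (?Q u w)) = (\<lambda>_. 0)" for v w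
      unfolding killing_ric[OF X sym] second
      by (rule has_derivative_unique[OF _ has_derivative_const])
    then have "ric \<Gamma> (?Q u v) w + ric \<Gamma> v (?Q u w) = 0" for u v w by (rule fun_cong)
    moreover have "?Q u v = ?Q v u" for u v
      using christoffel_sym[of \<Gamma>, OF sym] by (simp add: killing_form_def)
    ultimately have "ric \<Gamma> (?Q u v) w = 0" for u v w
      using ric_sym[of \<Gamma>, OF sym] by (intro skew_invariant_form_zero[of ?Q "ric \<Gamma>"])
    then have "\<forall>u. ric \<Gamma> u (?Q v w) = 0" for v w
      by (simp add: ric_sym[of \<Gamma> _ "?Q v w", OF sym])
    then show "?Q v w = 0" for v w
      using nondeg unfolding ric_nondegenerate_def by blast
  qed (use killing_ric[OF X sym] linear_frechet_derivative_smooth[OF \<open>smooth X\<close>] in auto)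
  then have "(X has_derivative (\<lambda>_. 0)) (at p within UNIV)" for p
    using smooth_has_derivative[OF \<open>smooth X\<close>, of p] by (simp add: ext[of "frechet_derivative X (at p)" "\<lambda>_. 0"])
  from has_derivative_zero_constant[OF convex_UNIV this] that show ?thesis by blast
qed

section \<open>Explicit existence and uniqueness for constant coefficients\<close>

section \<open>Linear second order equations\<close>

text \<open>The equation \<xi>'' + P \<xi>' + Q \<xi> = K as a first order system for a pair of
  functions, so that solutions can be combined before their derivative is identified with
  \<open>deriv \<xi>\<close>.\<close>

definition linear_ode :: "real \<Rightarrow> real \<Rightarrow> real \<Rightarrow> (real \<Rightarrow> real) \<Rightarrow> (real \<Rightarrow> real) \<Rightarrow> bool" where
  "linear_ode P Q K \<xi> \<xi>' \<longleftrightarrow> (\<forall>t. (\<xi> has_real_derivative \<xi>' t) (at t) \<and>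
     (\<xi>' has_real_derivative K - P * \<xi>' t - Q * \<xi> t) (at t))"

lemma linear_ode_deriv:
  "(\<forall>t. \<xi> differentiable (at t) \<and> deriv \<xi> differentiable (at t) \<and>
     deriv (deriv \<xi>) t + P * deriv \<xi> t + Q * \<xi> t = K) \<longleftrightarrow> linear_ode P Q K \<xi> (deriv \<xi>)"
proof -
  have "(\<xi> differentiable (at t) \<and> deriv \<xi> differentiable (at t) \<and>
     deriv (deriv \<xi>) t + P * deriv \<xi> t + Q * \<xi> t = K) \<longleftrightarrow>
    (\<xi> has_real_derivative deriv \<xi> t) (at t) \<and>
     (deriv \<xi> has_real_derivative K - P * deriv \<xi> t - Q * \<xi> t) (at t)" for t
  proof -
    have "deriv (deriv \<xi>) t + P * deriv \<xi> t + Q * \<xi> t = K \<longleftrightarrow>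
        deriv (deriv \<xi>) t = K - P * deriv \<xi> t - Q * \<xi> t" by linarith
    then show ?thesis
      by (metis DERIV_deriv_iff_real_differentiable DERIV_imp_deriv)
  qed
  then show ?thesis by (simp add: linear_ode_def)
qed

lemma linear_ode_deriv_eq: "linear_ode P Q K \<xi> \<xi>' \<Longrightarrow> \<xi>' = deriv \<xi>"
  by (auto simp: linear_ode_def fun_eq_iff intro: DERIV_imp_deriv[symmetric])

lemma linear_ode_add:
  assumes "linear_ode P Q K \<xi> \<xi>'" "linear_ode P Q L \<eta> \<eta>'"
  shows "linear_ode P Q (K + L) (\<lambda>t. \<xi> t + \<eta> t) (\<lambda>t. \<xi>' t + \<eta>' t)"
  using assms unfolding linear_ode_def
  by (auto intro!: derivative_eq_intros simp: algebra_simps)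

text \<open>A fundamental system of \<eta>'' = D \<eta>, uniform in the sign of \<open>D\<close>:
  polynomial, hyperbolic or trigonometric. Later proofs use only the four properties listed.\<close>

lemma hyperbolic_pair_exists:
  obtains C S :: "real \<Rightarrow> real" where "C 0 = 1" "S 0 = 0"
    "\<And>t. (S has_real_derivative C t) (at t)" "\<And>t. (C has_real_derivative D * S t) (at t)"
proof -
  consider "D = 0" | "D > 0" | "D < 0" by linarith
  then show ?thesis
  proof cases
    case 1
    then show ?thesis by (intro that[of "\<lambda>_. 1" "\<lambda>t. t"]) (auto intro!: derivative_eq_intros)
  next
    case 2
    define w where "w = sqrt D"
    have w: "w > 0" "D = w * w" using 2 by (auto simp: w_def)
    show ?thesis
      by (rule that[of "\<lambda>t. cosh (w * t)" "\<lambda>t. sinh (w * t) / w"])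
        (use w in \<open>auto intro!: derivative_eq_intros\<close>)
  next
    case 3
    define w where "w = sqrt (- D)"
    have w: "w > 0" "D = - w * w" using 3 by (auto simp: w_def)
    show ?thesis
      by (rule that[of "\<lambda>t. cos (w * t)" "\<lambda>t. sin (w * t) / w"])
        (use w in \<open>auto intro!: derivative_eq_intros\<close>)
  qed
qed

text \<open>The substitution \<open>\<xi> t = exp (- P * t / 2) * \<eta> t\<close> turns the homogeneous equation into
  \<open>\<eta>'' = (P\<^sup>2 / 4 - Q) * \<eta>\<close>.\<close>

lemma homogeneous_ode_exists:
  obtains \<xi> \<xi>' where "linear_ode P Q 0 \<xi> \<xi>'" "\<xi> 0 = x" "\<xi>' 0 = y"
proof -
  obtain C S :: "real \<Rightarrow> real" where CS: "C 0 = 1" "S 0 = 0"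
    "\<And>t. (S has_real_derivative C t) (at t)" "\<And>t. (C has_real_derivative (P\<^sup>2 / 4 - Q) * S t) (at t)"
    using hyperbolic_pair_exists[of "P\<^sup>2 / 4 - Q"] by blast
  \<comment> \<open>The initial slope of \<open>\<eta>\<close>: differentiating the substitution at
    0 gives \<eta>'(0) = \<xi>'(0) + P/2 \<xi>(0).\<close>
  define b where "b = y + P * x / 2"
  define \<xi> where "\<xi> = (\<lambda>t. exp (- P * t / 2) * (x * C t + b * S t))"
  define \<xi>' where "\<xi>' = (\<lambda>t. exp (- P * t / 2) * (x * (P\<^sup>2 / 4 - Q) * S t + b * C t) - P / 2 * \<xi> t)"
  have e: "((\<lambda>t. exp (- P * t / 2)) has_real_derivative - P / 2 * exp (- P * t / 2)) (at t)" for t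
    by (auto intro!: derivative_eq_intros)
  have 1: "(\<xi> has_real_derivative \<xi>' t) (at t)" for t
    unfolding \<xi>_def \<xi>'_def by (auto intro!: derivative_eq_intros CS e simp: algebra_simps)
  have 2: "(\<xi>' has_real_derivative 0 - P * \<xi>' t - Q * \<xi> t) (at t)" for t
    unfolding \<xi>'_def
    by (rule derivative_eq_intros CS e 1 refl)+
      (simp add: \<xi>_def \<xi>'_def field_simps power2_eq_square)
  show ?thesis
    by (rule that[of \<xi> \<xi>']) (use 1 2 CS in \<open>auto simp: linear_ode_def \<xi>_def \<xi>'_def b_def\<close>)
qed

text \<open>A particular solution is constant, linear or quadratic, depending on which of
  \<open>Q\<close> and \<open>P\<close> vanish; a homogeneous solution then corrects the initial
  values.\<close>

lemma linear_ode_exists: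
  obtains \<xi> \<xi>' where "linear_ode P Q K \<xi> \<xi>'" "\<xi> 0 = x" "\<xi>' 0 = y"
proof -
  have "\<exists>\<eta> \<eta>'. linear_ode P Q K \<eta> \<eta>'"
  proof (cases "Q = 0")
    case False
    then have "linear_ode P Q K (\<lambda>_. K / Q) (\<lambda>_. 0)" by (simp add: linear_ode_def)
    then show ?thesis by blast
  next
    case Q: True
    show ?thesis
    proof (cases "P = 0")
      case False
      then have "linear_ode P Q K (\<lambda>t. K / P * t) (\<lambda>_. K / P)"
        using Q by (auto simp: linear_ode_def intro!: derivative_eq_intros)
      then show ?thesis by blast
    next
      case True
      then have "linear_ode P Q K (\<lambda>t. K / 2 * t\<^sup>2) (\<lambda>t. K * t)"
        using Q by (auto simp: linear_ode_def intro!: derivative_eq_intros)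
      then show ?thesis by blast
    qed
  qed
  then obtain \<eta> \<eta>' where \<eta>: "linear_ode P Q K \<eta> \<eta>'" by blast
  obtain \<xi> \<xi>' where \<xi>: "linear_ode P Q 0 \<xi> \<xi>'" "\<xi> 0 = x - \<eta> 0" "\<xi>' 0 = y - \<eta>' 0"
    using homogeneous_ode_exists by blast
  show ?thesis
    by (rule that[of "\<lambda>t. \<eta> t + \<xi> t" "\<lambda>t. \<eta>' t + \<xi>' t"]) (use linear_ode_add[OF \<eta> \<xi>(1)] \<xi>(2,3) in auto)
qed

text \<open>After the substitution \<eta> = exp(P t / 2) \<xi>, three combinations of \<eta>,
  \<eta>', \<open>C\<close>, \<open>S\<close> have derivative 0: the first is constantly 1, and the
  two containing \<eta> are constantly 0 by the initial values.\<close>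

lemma homogeneous_ode_unique:
  assumes ode: "linear_ode P Q 0 \<xi> \<xi>'" and "\<xi> 0 = 0" "\<xi>' 0 = 0"
  shows "\<xi> t = 0"
proof -
  define D where "D = P\<^sup>2 / 4 - Q"
  obtain C S :: "real \<Rightarrow> real" where CS: "C 0 = 1" "S 0 = 0"
    "\<And>t. (S has_real_derivative C t) (at t)" "\<And>t. (C has_real_derivative D * S t) (at t)"
    using hyperbolic_pair_exists[of D] by blast
  have const: "f t = f 0" if "\<And>t. (f has_real_derivative 0) (at t)" for f :: "real \<Rightarrow> real" and t
    using DERIV_isconst_all that by blast
  define \<eta> \<eta>' where "\<eta> = (\<lambda>t. exp (P * t / 2) * \<xi> t)"
    and "\<eta>' = (\<lambda>t. exp (P * t / 2) * (\<xi>' t + P / 2 * \<xi> t))"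
  have \<xi>: "(\<xi> has_real_derivative \<xi>' t) (at t)" "(\<xi>' has_real_derivative - P * \<xi>' t - Q * \<xi> t) (at t)" for t
    using ode by (auto simp: linear_ode_def)
  have e: "((\<lambda>t. exp (P * t / 2)) has_real_derivative P / 2 * exp (P * t / 2)) (at t)" for t
    by (auto intro!: derivative_eq_intros)
  have \<eta>: "(\<eta> has_real_derivative \<eta>' t) (at t)" for t
    unfolding \<eta>_def \<eta>'_def by (auto intro!: derivative_eq_intros \<xi> e simp: algebra_simps)
  have \<eta>': "(\<eta>' has_real_derivative D * \<eta> t) (at t)" for t
    unfolding \<eta>'_def \<eta>_def
    by (rule derivative_eq_intros \<xi> e refl)+ (simp add: D_def field_simps power2_eq_square)
  have "((\<lambda>t. C t * C t - D * (S t * S t)) has_real_derivative 0) (at t)" for t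
    by (rule derivative_eq_intros CS refl)+ (simp add: algebra_simps)
  from const[OF this] have 1: "C t * C t - D * (S t * S t) = 1" for t by (simp add: CS)
  have "((\<lambda>t. \<eta> t * C t - \<eta>' t * S t) has_real_derivative 0) (at t)" for t
    by (rule derivative_eq_intros CS \<eta> \<eta>' refl)+ (simp add: algebra_simps)
  from const[OF this] have 2: "\<eta> t * C t - \<eta>' t * S t = 0" for t
    by (simp add: CS \<eta>_def assms)
  have "((\<lambda>t. \<eta>' t * C t - D * (\<eta> t * S t)) has_real_derivative 0) (at t)" for t
    by (rule derivative_eq_intros CS \<eta> \<eta>' refl)+ (simp add: algebra_simps)
  from const[OF this] have 3: "\<eta>' t * C t - D * (\<eta> t * S t) = 0" for t
    by (simp add: CS \<eta>'_def assms)
  \<comment> \<open>Add \<open>C t\<close> times the second and \<open>S t\<close> times the third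
    invariant; the terms with \<open>\<eta>'\<close> cancel.\<close>
  have "\<eta> t * (C t * C t - D * (S t * S t)) = 0" using 2[of t] 3[of t] by algebra
  then show ?thesis using 1[of t] by (simp add: \<eta>_def)
qed

section \<open>Linear structure, change of coordinates, and the ansatz for Killing fields\<close>

section \<open>Spaces of Killing fields\<close>

lemma has_derivative_add_scaleR_smooth:
  assumes "smooth X" "smooth Y"
  shows "((\<lambda>p. X p + r *\<^sub>R Y p) has_derivative
    (\<lambda>v. frechet_derivative X (at p) v + r *\<^sub>R frechet_derivative Y (at p) v)) (at p)"
  by (intro has_derivative_add has_derivative_scaleR_right smooth_has_derivative assms)

lemma smooth_add_scaleR:
  assumes "smooth X" "smooth Y"
  shows "smooth (\<lambda>p. X p + r *\<^sub>R Y p)"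
proof (rule smooth_coinduct[where F = "{\<lambda>p. X p + r *\<^sub>R Y p | X Y. smooth X \<and> smooth Y}"])
  show "(\<lambda>p. X p + r *\<^sub>R Y p) \<in> {\<lambda>p. X p + r *\<^sub>R Y p | X Y. smooth X \<and> smooth Y}"
    by (intro CollectI exI[of _ X] exI[of _ Y] conjI refl assms)
next
  fix f v p assume "f \<in> {\<lambda>p. X p + r *\<^sub>R Y p | X Y. smooth X \<and> smooth Y}"
  then obtain X Y where f: "f = (\<lambda>p. X p + r *\<^sub>R Y p)" "smooth X" "smooth Y" by blast
  note D = has_derivative_add_scaleR_smooth[OF f(2,3), of r, folded f(1)]
  show "f differentiable (at p)" using D by (auto simp: differentiable_def)
  show "(\<lambda>p. frechet_derivative f (at p) v) \<in> {\<lambda>p. X p + r *\<^sub>R Y p | X Y. smooth X \<and> smooth Y}"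
    unfolding frechet_derivative_at[OF D, symmetric]
    by (rule CollectI, intro exI conjI, rule refl) (intro smooth_deriv f(2,3))+
qed

lemma killing_add_scaleR:
  assumes X: "X \<in> killing \<Gamma>" and Y: "Y \<in> killing \<Gamma>"
  shows "(\<lambda>p. X p + r *\<^sub>R Y p) \<in> killing \<Gamma>"
proof -
  have s: "smooth X" "smooth Y" using assms by (auto simp: killing_iff)
  have "killing_form \<Gamma> (\<lambda>v. L v + r *\<^sub>R M v) v w = killing_form \<Gamma> L v w + r *\<^sub>R killing_form \<Gamma> M v w"
    for L M :: "real^'a \<Rightarrow> real^'a" and v w
    by (simp add: killing_form_def christoffel.add_left christoffel.add_right
        christoffel.scaleR_left christoffel.scaleR_right algebra_simps)
  then show ?thesis
    unfolding killing_iff frechet_derivative_at[OF has_derivative_add_scaleR_smooth[OF s], symmetric]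
      frechet_derivative_at[OF has_derivative_add_scaleR_smooth[OF smooth_deriv[OF s(1)] smooth_deriv[OF s(2)]], symmetric]
    using X Y smooth_add_scaleR[OF s] by (simp add: killing_iff)
qed

text \<open>Push-forward by a linear coordinate change \<open>T\<close> undone by \<open>S\<close>.
  A linear map has no second derivative, so the symbols transform like a tensor and the Killing
  equation is carried over term by term.\<close>

lemma killing_conj:
  assumes X: "X \<in> killing \<Gamma>" and lin: "linear T" "linear S" and ST: "\<And>v. S (T v) = v"
    and \<Gamma>': "\<And>v w. christoffel \<Gamma>' v w = T (christoffel \<Gamma> (S v) (S w))"
  shows "(\<lambda>p. T (X (S p))) \<in> killing \<Gamma>'"
proof -
  have X': "smooth X" "\<And>p v w. frechet_derivative (\<lambda>q. frechet_derivative X (at q) w) (at p) v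
       = killing_form \<Gamma> (frechet_derivative X (at p)) v w" using X by (auto simp: killing_iff)
  have bl: "bounded_linear T" "bounded_linear S" using lin by (auto simp: linear_conv_bounded_linear)
  note D = frechet_derivative_comp_linear(1)[OF _ bl(2,1)]
  show ?thesis
    unfolding killing_iff D[OF X'(1)] D[OF smooth_deriv[OF X'(1)]] X'(2) killing_form_def \<Gamma>' ST
    using smooth_comp_linear[OF X'(1) bl(2,1)] by (simp add: linear_diff[OF lin(1)])
qed

text \<open>Conjugation does not change the trace that defines the Ricci form.\<close>

lemma ric_conj:
  assumes lin: "linear T" "linear S" and ST: "\<And>v. S (T v) = v"
    and \<Gamma>': "\<And>v w. christoffel \<Gamma>' v w = T (christoffel \<Gamma> (S v) (S w))"
  shows "ric \<Gamma>' v w = ric \<Gamma> (S v) (S w)"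
proof -
  let ?R = "\<lambda>z. riem \<Gamma> z (S v) (S w)"
  have "ric \<Gamma>' v w = trace (matrix (T \<circ> (?R \<circ> S)))"
    by (simp add: ric_def riem_def \<Gamma>' ST linear_diff[OF lin(1)] o_def)
  also have "\<dots> = trace (matrix ((?R \<circ> S) \<circ> T))"
    unfolding matrix_compose[OF linear_compose[OF lin(2) linear_riem] lin(1)]
      matrix_compose[OF lin(1) linear_compose[OF lin(2) linear_riem]]
    by (rule trace_mul_sym)
  also have "(?R \<circ> S) \<circ> T = ?R" by (simp add: fun_eq_iff ST)
  finally show ?thesis by (simp add: ric_def)
qed

lemma edim_range:
  fixes \<Phi> :: "'a::euclidean_space \<Rightarrow> 'b::real_vector"
  assumes "linear \<Phi>" "inj \<Phi>"
  shows "edim (range \<Phi>) = DIM('a)"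
proof -
  have span: "range \<Phi> = span (\<Phi> ` Basis)"
    using linear_span_image[OF assms(1), of Basis] by simp
  have "independent (\<Phi> ` Basis)"
    using linear_independent_injective_image[OF assms(1) independent_Basis] assms(2)
    by (simp add: inj_on_subset[OF _ subset_UNIV])
  then have "dim (span (\<Phi> ` Basis)) = card (\<Phi> ` Basis)" by (rule dim_span_eq_card_independent)
  also have "\<dots> = DIM('a)" using assms(2) by (intro card_image) (rule inj_on_subset[OF _ subset_UNIV])
  finally have "dim (range \<Phi>) = DIM('a)" using span by simp
  \<comment> \<open>Without a finite spanning set \<open>edim\<close> would return its default
    \<infinity>.\<close>
  moreover have "\<exists>B. finite B \<and> range \<Phi> \<subseteq> span B"
    using span by (intro exI[of _ "\<Phi> ` Basis"]) simp
  ultimately show ?thesis by (simp add: edim_def)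
qed

lemma killing0_eq: "killing0 = range (\<lambda>c _. c)"
proof
  have "subspace (range (\<lambda>c _. c) :: 2 vfield set)"
    by (intro linear_subspace_image subspace_UNIV linearI) (auto simp: scaleR_fun_def)
  then show "killing0 \<subseteq> range (\<lambda>c _. c)"
    unfolding killing0_def by (intro span_minimal) (auto simp: coord_field_def)
next
  show "range (\<lambda>c _. c) \<subseteq> killing0"
  proof
    fix X :: "2 vfield" assume "X \<in> range (\<lambda>c _. c)"
    then obtain c where "X = (\<lambda>_. c)" by blast
    then have "X = c $ 1 *\<^sub>R coord_field 1 + c $ 2 *\<^sub>R coord_field 2"
      using vec2_expand[of c] by (simp add: fun_eq_iff scaleR_fun_def coord_field_def)
    then show "X \<in> killing0"
      unfolding killing0_def by (auto intro: span_add span_scale span_base)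
  qed
qed

text \<open>One ansatz for both cases of the first assertion: \<open>\<delta> = 0\<close> gives the
  exponential form, and for \<open>a = 0\<close> the exponential factor is 1 and
  \<open>\<delta>\<close> is the coefficient of the linear term.\<close>

definition normal_field :: "real \<Rightarrow> (real \<Rightarrow> real) \<Rightarrow> real \<Rightarrow> real^2 \<Rightarrow> 2 vfield" where
  "normal_field a \<xi> \<delta> c = (\<lambda>p. (exp (- a * p $ 1) * \<xi> (p $ 2) + \<delta> * p $ 1) *\<^sub>R axis 1 1 + c)"

text \<open>The derivative in a fixed direction is written as a normal field again, so that the rule
  can be iterated for second derivatives and for smoothness.\<close>

lemma has_derivative_normal_field:
  assumes "\<And>t. (\<xi> has_real_derivative \<xi>' t) (at t)"
  shows "(normal_field a \<xi> \<delta> c has_derivative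
    (\<lambda>v. normal_field a (\<lambda>t. v $ 2 * \<xi>' t - a * v $ 1 * \<xi> t) 0 ((\<delta> * v $ 1) *\<^sub>R axis 1 1) p)) (at p)"
proof -
  have nth: "((\<lambda>p::real^2. p $ i) has_derivative (\<lambda>v. v $ i)) (at p)" for i
    by (rule bounded_linear_imp_has_derivative) (rule bounded_linear_vec_nth)
  have e: "((\<lambda>p::real^2. exp (- a * p $ 1)) has_derivative (\<lambda>v. (- a * v $ 1) * exp (- a * p $ 1))) (at p)"
    by (rule DERIV_compose_FDERIV[OF DERIV_exp has_derivative_mult_right[OF nth]])
  have x: "((\<lambda>p::real^2. \<xi> (p $ 2)) has_derivative (\<lambda>v. v $ 2 * \<xi>' (p $ 2))) (at p)"
    by (rule DERIV_compose_FDERIV[OF assms nth])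
  show ?thesis
    unfolding normal_field_def
    by (rule derivative_eq_intros e x nth refl)+
      (simp add: fun_eq_iff vec_eq_iff forall_2 axis_def algebra_simps)
qed

lemma frechet_derivative_normal_field:
  assumes "\<And>t. (\<xi> has_real_derivative \<xi>' t) (at t)"
  shows "frechet_derivative (normal_field a \<xi> \<delta> c) (at p) v =
    normal_field a (\<lambda>t. v $ 2 * \<xi>' t - a * v $ 1 * \<xi> t) 0 ((\<delta> * v $ 1) *\<^sub>R axis 1 1) p"
  unfolding frechet_derivative_at[OF has_derivative_normal_field[OF assms], symmetric] ..

text \<open>The profiles spanned by \<open>\<xi>\<close>, \<open>\<xi>'\<close> and 1 are closed
  under differentiation, because the equation expresses the derivative of \<open>\<xi>'\<close>
  through them; the constant 1 accounts for \<open>K\<close>.\<close>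

lemma smooth_normal_field:
  assumes "linear_ode P Q K \<xi> \<xi>'"
  shows "smooth (normal_field a \<xi> \<delta> c)"
proof (rule smooth_coinduct[where F = "{normal_field a (\<lambda>t. x * \<xi> t + y * \<xi>' t + z) \<delta> c | x y z \<delta> c. True}"])
  have "normal_field a \<xi> \<delta> c = normal_field a (\<lambda>t. 1 * \<xi> t + 0 * \<xi>' t + 0) \<delta> c" by simp
  then show "normal_field a \<xi> \<delta> c \<in> {normal_field a (\<lambda>t. x * \<xi> t + y * \<xi>' t + z) \<delta> c | x y z \<delta> c. True}"
    by blast
next
  fix f p v assume "f \<in> {normal_field a (\<lambda>t. x * \<xi> t + y * \<xi>' t + z) \<delta> c | x y z \<delta> c. True}"
  then obtain x y z \<delta> c where f: "f = normal_field a (\<lambda>t. x * \<xi> t + y * \<xi>' t + z) \<delta> c" by blast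
  have ode: "(\<xi> has_real_derivative \<xi>' t) (at t)" "(\<xi>' has_real_derivative K - P * \<xi>' t - Q * \<xi> t) (at t)" for t
    using assms by (auto simp: linear_ode_def)
  have D: "((\<lambda>t. x * \<xi> t + y * \<xi>' t + z) has_real_derivative
      x * \<xi>' t + y * (K - P * \<xi>' t - Q * \<xi> t)) (at t)" for t
    by (auto intro!: derivative_eq_intros ode)
  show "f differentiable (at p)"
    unfolding f differentiable_def using has_derivative_normal_field[OF D] by blast
  have "(\<lambda>p. frechet_derivative f (at p) v) = normal_field a
    (\<lambda>t. (- v $ 2 * y * Q - a * v $ 1 * x) * \<xi> t + (v $ 2 * x - v $ 2 * y * P - a * v $ 1 * y) * \<xi>' t
      + (v $ 2 * y * K - a * v $ 1 * z)) 0 ((\<delta> * v $ 1) *\<^sub>R axis 1 1)"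
    unfolding f frechet_derivative_normal_field[OF D] by (simp add: normal_field_def algebra_simps)
  then show "(\<lambda>p. frechet_derivative f (at p) v)
      \<in> {normal_field a (\<lambda>t. x * \<xi> t + y * \<xi>' t + z) \<delta> c | x y z \<delta> c. True}"
    by blast
qed

section \<open>Rank one Ricci form: solution of the Killing equation in adapted coordinates\<close>

section \<open>Surfaces with degenerate Ricci form\<close>

text \<open>The first two conclusions say that the kernel direction of the Ricci form is
  parallel.\<close>

lemma ric_kernel_axis_1:
  fixes \<Gamma> :: "2 \<Rightarrow> 2 \<Rightarrow> 2 \<Rightarrow> real"
  assumes sym: "\<And>i j k. \<Gamma> i j k = \<Gamma> j i k"
    and ker: "ric \<Gamma> (axis 1 1) (axis 1 1) = 0" "ric \<Gamma> (axis 1 1) (axis 2 1) = 0"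
    and nonzero: "ric \<Gamma> v w \<noteq> 0"
  shows "\<Gamma> 1 1 2 = 0" "\<Gamma> 1 2 2 = 0"
    "\<And>v w. ric \<Gamma> v w = ric \<Gamma> (axis 2 1) (axis 2 1) * (v $ 2 * w $ 2)"
    "ric \<Gamma> (axis 2 1) (axis 2 1) \<noteq> 0"
proof -
  have 11: "\<Gamma> 1 2 2 * (\<Gamma> 1 1 1 - \<Gamma> 1 2 2) + \<Gamma> 1 1 2 * (\<Gamma> 2 2 2 - \<Gamma> 1 2 1) = 0"
    and 12: "\<Gamma> 1 2 1 * \<Gamma> 1 2 2 - \<Gamma> 1 1 2 * \<Gamma> 2 2 1 = 0"
    using ker by (simp_all add: ric_2[OF sym] axis_def)
  have 22: "ric \<Gamma> (axis 2 1) (axis 2 1) =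
      \<Gamma> 1 2 1 * (\<Gamma> 2 2 2 - \<Gamma> 1 2 1) + \<Gamma> 2 2 1 * (\<Gamma> 1 1 1 - \<Gamma> 1 2 2)"
    by (simp add: ric_2[OF sym] axis_def)
  show ric: "ric \<Gamma> v w = ric \<Gamma> (axis 2 1) (axis 2 1) * (v $ 2 * w $ 2)" for v w
    unfolding 22 by (simp only: ric_2[OF sym] 11 12) simp
  show nz: "ric \<Gamma> (axis 2 1) (axis 2 1) \<noteq> 0"
    using nonzero unfolding ric[of v w] by auto
  \<comment> \<open>Fact \<open>12\<close> trades \<open>\<Gamma> 1 1 2 * \<Gamma> 2 2 1\<close> for
    \<open>\<Gamma> 1 2 1 * \<Gamma> 1 2 2\<close>, which turns the product into
    \<open>\<Gamma> 1 2 1\<close> times the left side of \<open>11\<close>.\<close>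
  have "\<Gamma> 1 1 2 * ric \<Gamma> (axis 2 1) (axis 2 1) = 0" unfolding 22 using 11 12 by algebra
  then show "\<Gamma> 1 1 2 = 0" using nz by simp
  have "\<Gamma> 1 2 2 * ric \<Gamma> (axis 2 1) (axis 2 1) = 0" unfolding 22 using 11 12 \<open>\<Gamma> 1 1 2 = 0\<close> by algebra
  then show "\<Gamma> 1 2 2 = 0" using nz by simp
qed

text \<open>Coordinates whose first axis spans the kernel of the Ricci form. The first assertion is
  stated in such coordinates; the dimension count reaches them by a linear change.\<close>

locale degenerate_normal_form =
  fixes \<Gamma> :: "2 \<Rightarrow> 2 \<Rightarrow> 2 \<Rightarrow> real"
  assumes sym: "\<And>i j k. \<Gamma> i j k = \<Gamma> j i k"
    and ker: "ric \<Gamma> (axis 1 1) (axis 1 1) = 0" "ric \<Gamma> (axis 1 1) (axis 2 1) = 0"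
    and nonzero: "\<exists>v w. ric \<Gamma> v w \<noteq> 0"
begin

lemma \<Gamma>_zero: "\<Gamma> 1 1 2 = 0" "\<Gamma> 1 2 2 = 0"
  and ric_eq: "\<And>v w. ric \<Gamma> v w = ric \<Gamma> (axis 2 1) (axis 2 1) * (v $ 2 * w $ 2)"
  and ric_22: "ric \<Gamma> (axis 2 1) (axis 2 1) \<noteq> 0"
  using nonzero ric_kernel_axis_1[OF sym ker] by blast+

abbreviation a where "a \<equiv> \<Gamma> 1 1 1"

abbreviation e where "e \<equiv> \<Gamma> 2 2 1"

abbreviation P where "P \<equiv> 2 * \<Gamma> 1 2 1 - \<Gamma> 2 2 2"

text \<open>The right-hand side of the Killing equation when only the first component of the field
  varies, with gradient \<open>x\<close>, \<open>y\<close>.\<close>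

lemma killing_form_normal:
  assumes L: "\<And>v. L v $ 1 = v $ 1 * x + v $ 2 * y" "\<And>v. L v $ 2 = 0"
  shows "killing_form \<Gamma> L v w $ 1 =
      - a * (v $ 1 * w $ 1 * x + (v $ 1 * w $ 2 + v $ 2 * w $ 1) * y) + v $ 2 * w $ 2 * (e * x - P * y)"
    and "killing_form \<Gamma> L v w $ 2 = 0"
  by (simp_all add: killing_form_def L christoffel_2 \<Gamma>_zero sym[of 2 1] algebra_simps)

lemma normal_field_killing:
  assumes a\<delta>: "a = 0 \<or> \<delta> = 0" and ode: "linear_ode P (a * e) (\<delta> * e) \<xi> \<xi>'"
  shows "normal_field a \<xi> \<delta> c \<in> killing \<Gamma>"
  unfolding killing_iff
proof (intro conjI allI)
  show "smooth (normal_field a \<xi> \<delta> c)" using ode by (rule smooth_normal_field)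
next
  fix p v w :: "real^2"
  let ?X = "normal_field a \<xi> \<delta> c"
  have d: "(\<xi> has_real_derivative \<xi>' t) (at t)"
    "(\<xi>' has_real_derivative \<delta> * e - P * \<xi>' t - a * e * \<xi> t) (at t)" for t
    using ode by (auto simp: linear_ode_def)
  note D = frechet_derivative_normal_field[OF d(1)]
  have d2: "((\<lambda>t. w $ 2 * \<xi>' t - a * w $ 1 * \<xi> t) has_real_derivative
      w $ 2 * (\<delta> * e - P * \<xi>' t - a * e * \<xi> t) - a * w $ 1 * \<xi>' t) (at t)" for t
    by (auto intro!: derivative_eq_intros d)
  define E where "E = exp (- a * p $ 1)"
  have L: "frechet_derivative ?X (at p) v $ 1 = v $ 1 * (\<delta> - a * E * \<xi> (p $ 2)) + v $ 2 * (E * \<xi>' (p $ 2))"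
    "frechet_derivative ?X (at p) v $ 2 = 0" for v
    unfolding D by (simp_all add: normal_field_def E_def axis_def algebra_simps)
  \<comment> \<open>If \<open>a = 0\<close> then \<open>E = 1\<close>; otherwise
    \<open>\<delta> = 0\<close>. The two sides of the identity \<open>alg\<close> differ by a
    combination of just these two relations.\<close>
  have E: "\<delta> * E = \<delta>" "\<delta> * a = 0" using a\<delta> by (auto simp: E_def)
  have alg: "E * (v2 * (w2 * (\<delta> * k - r * z' - a * k * z) - a * w1 * z') - a * v1 * (w2 * z' - a * w1 * z)) =
      - a * (v1 * w1 * (\<delta> - a * E * z) + (v1 * w2 + v2 * w1) * (E * z')) +
      v2 * w2 * (k * (\<delta> - a * E * z) - r * (E * z'))" for v1 v2 w1 w2 k r z z' :: real
  proof -
    have "E * (v2 * (w2 * (\<delta> * k - r * z' - a * k * z) - a * w1 * z') - a * v1 * (w2 * z' - a * w1 * z))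
      - (- a * (v1 * w1 * (\<delta> - a * E * z) + (v1 * w2 + v2 * w1) * (E * z')) +
        v2 * w2 * (k * (\<delta> - a * E * z) - r * (E * z')))
      = v2 * w2 * k * (\<delta> * E - \<delta>) + v1 * w1 * (\<delta> * a)"
      by (simp add: algebra_simps)
    then show ?thesis unfolding E by simp
  qed
  have "frechet_derivative (\<lambda>q. frechet_derivative ?X (at q) w) (at p) v $ 1 =
      E * (v $ 2 * (w $ 2 * (\<delta> * e - P * \<xi>' (p $ 2) - a * e * \<xi> (p $ 2)) - a * w $ 1 * \<xi>' (p $ 2))
        - a * v $ 1 * (w $ 2 * \<xi>' (p $ 2) - a * w $ 1 * \<xi> (p $ 2)))"
    unfolding D frechet_derivative_normal_field[OF d2] by (simp add: normal_field_def E_def axis_def)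
  also have "\<dots> = killing_form \<Gamma> (frechet_derivative ?X (at p)) v w $ 1"
    unfolding killing_form_normal(1)[OF L] by (rule alg)
  finally have "frechet_derivative (\<lambda>q. frechet_derivative ?X (at q) w) (at p) v $ 1
       = killing_form \<Gamma> (frechet_derivative ?X (at p)) v w $ 1" .
  moreover have "frechet_derivative (\<lambda>q. frechet_derivative ?X (at q) w) (at p) v $ 2 = 0"
    unfolding D frechet_derivative_normal_field[OF d2] by (simp add: normal_field_def axis_def)
  ultimately show "frechet_derivative (\<lambda>q. frechet_derivative ?X (at q) w) (at p) v
       = killing_form \<Gamma> (frechet_derivative ?X (at p)) v w"
    using killing_form_normal(2)[OF L, of v w] by (simp only: vec_eq_iff forall_2)
qed

text \<open>Skewness leaves only the first component variable. Its gradient \<open>u1\<close>,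
  \<open>u2\<close> satisfies a closed linear system, which is integrated along the second axis by
  the equation for \<open>\<xi>\<close> and along horizontal lines by an integrating factor.\<close>

lemma killing_normal_field:
  assumes X: "X \<in> killing \<Gamma>"
  obtains \<xi> \<xi>' \<delta> c where "a = 0 \<or> \<delta> = 0" "linear_ode P (a * e) (\<delta> * e) \<xi> \<xi>'"
    "X = normal_field a \<xi> \<delta> c"
proof -
  let ?e1 = "axis 1 1 :: real^2" and ?e2 = "axis 2 1 :: real^2"
  define L where "L p = frechet_derivative X (at p)" for p
  define u1 u2 where "u1 p = L p ?e1 $ 1" and "u2 p = L p ?e2 $ 1" for p
  from X have "smooth X" by (simp add: killing_iff)
  have dX: "(X has_derivative L p) (at p)" for p
    unfolding L_def by (rule smooth_has_derivative) fact
  have lin: "linear (L p)" for p using dX has_derivative_linear by blast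
  have L2: "L p v $ 2 = 0" for p v
  proof -
    have skew: "L p v $ 2 * w $ 2 + v $ 2 * L p w $ 2 = 0" for v w
    proof -
      have "ric \<Gamma> ?e2 ?e2 * (L p v $ 2 * w $ 2 + v $ 2 * L p w $ 2) = 0"
        using killing_ric[OF X sym, of p v w, folded L_def]
        unfolding ric_eq[of "L p v" w] ric_eq[of v "L p w"] by (simp add: algebra_simps)
      then show ?thesis using ric_22 by simp
    qed
    have "L p ?e2 $ 2 = 0" using skew[of ?e2 ?e2] by (simp add: axis_def)
    then show ?thesis using skew[of v ?e2] by (simp add: axis_def)
  qed
  have L1: "L p v $ 1 = v $ 1 * u1 p + v $ 2 * u2 p" for p v
    by (subst vec2_expand[of v]) (simp add: linear_add[OF lin] linear_scale[OF lin] u1_def u2_def)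
  have second: "frechet_derivative (\<lambda>q. L q w) (at p) v = killing_form \<Gamma> (L p) v w" for p v w
    using X by (simp add: killing_iff L_def)
  have dL: "((\<lambda>q. L q w) has_derivative (\<lambda>v. killing_form \<Gamma> (L p) v w)) (at p)" for p w
  proof -
    have "((\<lambda>q. L q w) has_derivative frechet_derivative (\<lambda>q. L q w) (at p)) (at p)"
      unfolding L_def by (intro smooth_has_derivative smooth_deriv) fact
    then show ?thesis by (simp add: second[abs_def])
  qed
  have nth: "((\<lambda>q. f q $ i) has_derivative (\<lambda>v. f' v $ i)) F"
    if "(f has_derivative f') F" for f :: "'b::real_normed_vector \<Rightarrow> real^2" and f' F i
    using bounded_linear.has_derivative[OF bounded_linear_vec_nth that] .
  have du: "((\<lambda>q. X q $ 1) has_derivative (\<lambda>v. v $ 1 * u1 p + v $ 2 * u2 p)) (at p)" for p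
    using nth[OF dX, of 1 p] by (simp add: L1)
  have du1: "(u1 has_derivative (\<lambda>v. - a * (v $ 1 * u1 p + v $ 2 * u2 p))) (at p)" for p
    using nth[OF dL, of ?e1 1 p] killing_form_normal(1)[OF L1 L2]
    by (simp add: u1_def[abs_def] axis_def)
  have du2: "(u2 has_derivative (\<lambda>v. - a * (v $ 1 * u2 p) + v $ 2 * (e * u1 p - P * u2 p))) (at p)" for p
    using nth[OF dL, of ?e2 1 p] killing_form_normal(1)[OF L1 L2]
    by (simp add: u2_def[abs_def] axis_def)
  have const: "f p = f q" if "\<And>p. (f has_derivative (\<lambda>_. 0)) (at p)"
    for f :: "'b::real_normed_vector \<Rightarrow> real" and p q
    using has_derivative_zero_unique[OF convex_UNIV] that by (metis UNIV_I)
  have X2: "X p $ 2 = X 0 $ 2" for p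
    by (rule const) (use nth[OF dX, of 2] in \<open>simp add: L2\<close>)
  \<comment> \<open>A first integral: by \<open>du1\<close> the differential of \<open>u1\<close> is
    \<open>- a\<close> times that of the first component of \<open>X\<close>.\<close>
  define k where "k = u1 0 + a * X 0 $ 1"
  have k: "u1 p + a * X p $ 1 = k" for p
    unfolding k_def
  proof (rule const[of "\<lambda>p. u1 p + a * X p $ 1" p 0])
    fix p
    show "((\<lambda>p. u1 p + a * X p $ 1) has_derivative (\<lambda>_. 0)) (at p)"
      by (rule derivative_eq_intros du du1 refl)+ (simp add: fun_eq_iff)
  qed
  \<comment> \<open>The first integral reads \<open>u1 = k - a * X $ 1\<close>. For
    \<open>a \<noteq> 0\<close> the constant \<open>k\<close> is absorbed by shifting the first
    component by \<open>m\<close>; for \<open>a = 0\<close> it is the slope in the first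
    coordinate.\<close>
  define m \<delta> where "m = (if a = 0 then 0 else k / a)" and "\<delta> = (if a = 0 then k else 0)"
  have a\<delta>: "a = 0 \<or> \<delta> = 0" and m\<delta>: "a * m + \<delta> = k" by (auto simp: m_def \<delta>_def)
  define \<xi> \<xi>' where "\<xi> t = X (t *\<^sub>R ?e2) $ 1 - m" and "\<xi>' t = u2 (t *\<^sub>R ?e2)" for t
  have line: "((\<lambda>t. f (q + t *\<^sub>R w)) has_real_derivative f' w) (at t)"
    if "(f has_derivative f') (at (q + t *\<^sub>R w))" for f f' and q w :: "real^2" and t
  proof -
    have "((\<lambda>t. f (q + t *\<^sub>R w)) has_derivative (\<lambda>s. f' (s *\<^sub>R w))) (at t)"
      by (rule has_derivative_compose[of "\<lambda>t. q + t *\<^sub>R w" "\<lambda>s. s *\<^sub>R w" t UNIV f f', OF _ that]) (auto intro!: derivative_eq_intros)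
    then show ?thesis
      by (simp add: has_field_derivative_def linear_scale[OF has_derivative_linear[OF that]] mult_commute_abs)
  qed
  have d\<xi>: "(\<xi> has_real_derivative \<xi>' t) (at t)" for t
    using line[of _ _ 0 t ?e2, OF du] unfolding \<xi>_def \<xi>'_def
    by (auto intro!: derivative_eq_intros simp: axis_def)
  have d\<xi>': "(\<xi>' has_real_derivative \<delta> * e - P * \<xi>' t - a * e * \<xi> t) (at t)" for t
  proof -
    have "u1 (t *\<^sub>R ?e2) = \<delta> - a * \<xi> t"
      using k[of "t *\<^sub>R ?e2"] m\<delta> by (simp add: \<xi>_def algebra_simps)
    then have "\<delta> * e - P * \<xi>' t - a * e * \<xi> t = e * u1 (t *\<^sub>R ?e2) - P * \<xi>' t"
      by (simp only:) (simp add: algebra_simps)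
    moreover have "(\<xi>' has_real_derivative e * u1 (t *\<^sub>R ?e2) - P * \<xi>' t) (at t)"
      using line[of _ _ 0 t ?e2, OF du2] by (simp add: \<xi>'_def[abs_def] axis_def)
    ultimately show ?thesis by (simp only:)
  qed
  have u: "X p $ 1 = exp (- a * p $ 1) * \<xi> (p $ 2) + \<delta> * p $ 1 + m" for p
  proof -
    define q where "q = p $ 2 *\<^sub>R ?e2"
    \<comment> \<open>Integrating factor on the horizontal line through \<open>p\<close>, started on
      the second axis, where the value is \<open>\<xi> (p $ 2)\<close>.\<close>
    define h where "h s = (X (q + s *\<^sub>R ?e1) $ 1 - m - \<delta> * s) * exp (a * s)" for s
    have "(h has_real_derivative 0) (at s)" for s
    proof -
      have dline: "((\<lambda>s. X (q + s *\<^sub>R ?e1) $ 1) has_real_derivative u1 (q + s *\<^sub>R ?e1)) (at s)"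
        using line[of _ _ q s ?e1, OF du] by (simp add: axis_def)
      have D: "(h has_real_derivative (u1 (q + s *\<^sub>R ?e1) - \<delta>) * exp (a * s)
          + (X (q + s *\<^sub>R ?e1) $ 1 - m - \<delta> * s) * (exp (a * s) * a)) (at s)"
        unfolding h_def by (auto intro!: derivative_eq_intros dline)
      have u1: "u1 (q + s *\<^sub>R ?e1) = \<delta> - a * (X (q + s *\<^sub>R ?e1) $ 1 - m)"
        using k[of "q + s *\<^sub>R ?e1"] m\<delta> by (simp add: algebra_simps)
      have "(u1 (q + s *\<^sub>R ?e1) - \<delta>) * exp (a * s)
          + (X (q + s *\<^sub>R ?e1) $ 1 - m - \<delta> * s) * (exp (a * s) * a) = - (a * \<delta>) * s * exp (a * s)"
        unfolding u1 by (simp add: algebra_simps)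
      also have "\<dots> = 0" using a\<delta> by auto
      finally show ?thesis using D by (simp only:)
    qed
    then have "h (p $ 1) = h 0" using DERIV_isconst_all by blast
    moreover have "q + p $ 1 *\<^sub>R ?e1 = p" using vec2_expand[of p] by (simp add: q_def add.commute)
    ultimately have "(X p $ 1 - m - \<delta> * p $ 1) * exp (a * p $ 1) = \<xi> (p $ 2)"
      by (simp add: h_def \<xi>_def q_def)
    then have "exp (- a * p $ 1) * \<xi> (p $ 2) = X p $ 1 - m - \<delta> * p $ 1"
      by (simp add: exp_minus field_simps)
    then show ?thesis by simp
  qed
  show ?thesis
  proof (rule that[OF a\<delta>])
    show "linear_ode P (a * e) (\<delta> * e) \<xi> \<xi>'" using d\<xi> d\<xi>' by (simp add: linear_ode_def)
    show "X = normal_field a \<xi> \<delta> (vector [m, X 0 $ 2])"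
      by (simp add: fun_eq_iff normal_field_def vec_eq_iff forall_2 u X2[symmetric] axis_def)
        (use X2 in blast)
  qed
qed

text \<open>Uniqueness of a Killing field with given value and given gradient of the first component
  at the origin.\<close>

lemma killing_eq_zero:
  assumes X: "X \<in> killing \<Gamma>" and "X 0 = 0"
    and L: "frechet_derivative X (at 0) (axis 1 1) $ 1 = 0" "frechet_derivative X (at 0) (axis 2 1) $ 1 = 0"
  shows "X p = 0"
proof -
  obtain \<xi> \<xi>' \<delta> c where a\<delta>: "a = 0 \<or> \<delta> = 0" and ode: "linear_ode P (a * e) (\<delta> * e) \<xi> \<xi>'"
    and X_eq: "X = normal_field a \<xi> \<delta> c" using killing_normal_field[OF X] .
  have D: "frechet_derivative X (at 0) v =
    normal_field a (\<lambda>t. v $ 2 * \<xi>' t - a * v $ 1 * \<xi> t) 0 ((\<delta> * v $ 1) *\<^sub>R axis 1 1) 0" for v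
    unfolding X_eq using ode by (intro frechet_derivative_normal_field) (auto simp: linear_ode_def)
  have 1: "\<delta> - a * \<xi> 0 = 0" "\<xi>' 0 = 0"
    using L unfolding D by (simp_all add: normal_field_def axis_def)
  then have "\<delta> = 0" "a * \<xi> 0 = 0" using a\<delta> by auto
  have c: "c $ 2 = 0" "\<xi> 0 + c $ 1 = 0"
    using \<open>X 0 = 0\<close> by (simp_all add: X_eq normal_field_def vec_eq_iff forall_2 axis_def)
  \<comment> \<open>Since \<open>a * \<xi> 0 = 0\<close>, constants equal to
    \<open>- \<xi> 0\<close> solve the homogeneous equation. Subtracting \<open>\<xi> 0\<close>
    gives a solution with zero initial data, so \<open>\<xi>\<close> is constant and the field
    reduces to its value at the origin.\<close>
  have "linear_ode P (a * e) 0 (\<lambda>_. - \<xi> 0) (\<lambda>_. 0)"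
    using \<open>a * \<xi> 0 = 0\<close> by (auto simp: linear_ode_def)
  from linear_ode_add[OF ode this]
  have "linear_ode P (a * e) 0 (\<lambda>t. \<xi> t + - \<xi> 0) (\<lambda>t. \<xi>' t + 0)" by (simp add: \<open>\<delta> = 0\<close>)
  from homogeneous_ode_unique[OF this] have \<xi>: "\<xi> t = \<xi> 0" for t using 1 by simp
  have exp: "exp (- a * p $ 1) * \<xi> 0 = \<xi> 0" using \<open>a * \<xi> 0 = 0\<close> by auto
  show ?thesis
    unfolding X_eq normal_field_def \<xi>[of "p $ 2"] exp \<open>\<delta> = 0\<close>
    using c by (simp add: vec_eq_iff forall_2 axis_def)
qed

lemma killing_jet_exists:
  obtains X where "X \<in> killing \<Gamma>" "X 0 = 0"
    "frechet_derivative X (at 0) (axis 1 1) $ 1 = x" "frechet_derivative X (at 0) (axis 2 1) $ 1 = y"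
proof -
  \<comment> \<open>The first component of a normal field has gradient
    \<open>\<delta> - a * \<xi> 0\<close>, \<open>\<xi>' 0\<close> at the origin. So
    \<open>x\<close> is supplied by \<open>\<delta>\<close> if \<open>a = 0\<close> and by
    \<open>\<xi> 0\<close> otherwise; the constant summand of the field then cancels its value
    there.\<close>
  define \<delta> x0 where "\<delta> = (if a = 0 then x else 0)" and "x0 = (if a = 0 then 0 else - x / a)"
  have a\<delta>: "a = 0 \<or> \<delta> = 0" and x: "\<delta> - a * x0 = x" by (auto simp: \<delta>_def x0_def)
  obtain \<xi> \<xi>' where ode: "linear_ode P (a * e) (\<delta> * e) \<xi> \<xi>'" "\<xi> 0 = x0" "\<xi>' 0 = y"
    using linear_ode_exists by blast
  let ?X = "normal_field a \<xi> \<delta> (- x0 *\<^sub>R axis 1 1)"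
  have D: "frechet_derivative ?X (at 0) v =
    normal_field a (\<lambda>t. v $ 2 * \<xi>' t - a * v $ 1 * \<xi> t) 0 ((\<delta> * v $ 1) *\<^sub>R axis 1 1) 0" for v
    using ode(1) by (intro frechet_derivative_normal_field) (auto simp: linear_ode_def)
  show ?thesis
  proof (rule that)
    show "?X \<in> killing \<Gamma>" by (rule normal_field_killing[OF a\<delta> ode(1)])
    show "?X 0 = 0" by (simp add: normal_field_def ode vec_eq_iff forall_2 axis_def)
    show "frechet_derivative ?X (at 0) (axis 1 1) $ 1 = x" "frechet_derivative ?X (at 0) (axis 2 1) $ 1 = y"
      using x unfolding D by (simp_all add: normal_field_def axis_def ode)
  qed
qed

text \<open>Constant fields realize the values at the origin, and \<open>F\<close>, \<open>G\<close>
  realize the two unit gradients of the first component with value 0. Evaluating these data shows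
  injectivity, and \<open>killing_eq_zero\<close> applied to a difference shows
  surjectivity.\<close>

lemma killing_parametrization:
  obtains \<Phi> :: "(real^2) \<times> (real^2) \<Rightarrow> 2 vfield" where "linear \<Phi>" "inj \<Phi>" "range \<Phi> = killing \<Gamma>"
proof -
  let ?e1 = "axis 1 1 :: real^2" and ?e2 = "axis 2 1 :: real^2"
  obtain F where F: "F \<in> killing \<Gamma>" "F 0 = 0"
    "frechet_derivative F (at 0) ?e1 $ 1 = 1" "frechet_derivative F (at 0) ?e2 $ 1 = 0"
    using killing_jet_exists .
  obtain G where G: "G \<in> killing \<Gamma>" "G 0 = 0"
    "frechet_derivative G (at 0) ?e1 $ 1 = 0" "frechet_derivative G (at 0) ?e2 $ 1 = 1"
    using killing_jet_exists .
  define \<Phi> :: "(real^2) \<times> (real^2) \<Rightarrow> 2 vfield" where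
    "\<Phi> z = (\<lambda>p. (fst z + snd z $ 1 *\<^sub>R F p) + snd z $ 2 *\<^sub>R G p)" for z
  have in_killing: "\<Phi> z \<in> killing \<Gamma>" for z
    unfolding \<Phi>_def by (intro killing_add_scaleR killing_const F G)
  have s: "smooth F" "smooth G" using F G by (auto simp: killing_iff)
  have "(\<Phi> z has_derivative (\<lambda>v. (0 + snd z $ 1 *\<^sub>R frechet_derivative F (at 0) v)
      + snd z $ 2 *\<^sub>R frechet_derivative G (at 0) v)) (at 0)" for z
    unfolding \<Phi>_def
    by (intro has_derivative_add has_derivative_const has_derivative_scaleR_right smooth_has_derivative s)
  from frechet_derivative_at[OF this, symmetric]
  have D\<Phi>: "frechet_derivative (\<Phi> z) (at 0) ?e1 $ 1 = snd z $ 1"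
    "frechet_derivative (\<Phi> z) (at 0) ?e2 $ 1 = snd z $ 2" for z
    by (simp_all add: F G)
  have \<Phi>0: "\<Phi> z 0 = fst z" for z by (simp add: \<Phi>_def F G)
  show ?thesis
  proof (rule that)
    show "linear \<Phi>" by (intro linearI) (auto simp: \<Phi>_def scaleR_fun_def fun_eq_iff algebra_simps)
    show "inj \<Phi>"
    proof (rule injI)
      fix z z' assume eq: "\<Phi> z = \<Phi> z'"
      have "fst z = fst z'" using \<Phi>0[of z] \<Phi>0[of z'] eq by simp
      moreover have "snd z = snd z'"
        using D\<Phi>[of z] D\<Phi>[of z'] eq by (simp add: vec_eq_iff forall_2)
      ultimately show "z = z'" by (rule prod_eqI)
    qed
    have "X \<in> range \<Phi>" if X: "X \<in> killing \<Gamma>" for X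
    proof
      let ?L = "frechet_derivative X (at 0)"
      let ?z = "(X 0, vector [?L ?e1 $ 1, ?L ?e2 $ 1]) :: (real^2) \<times> (real^2)"
      define Y where "Y = (\<lambda>p. X p + (- 1) *\<^sub>R \<Phi> ?z p)"
      have Y: "Y \<in> killing \<Gamma>" unfolding Y_def by (intro killing_add_scaleR X in_killing)
      have s: "smooth X" "smooth (\<Phi> ?z)" using X in_killing[of ?z] by (auto simp: killing_iff)
      have DY: "frechet_derivative Y (at 0) v = ?L v + (- 1) *\<^sub>R frechet_derivative (\<Phi> ?z) (at 0) v" for v
        unfolding Y_def frechet_derivative_at[OF has_derivative_add_scaleR_smooth[OF s], symmetric] ..
      have Y0: "Y p = 0" for p
      proof (rule killing_eq_zero[OF Y])
        show "Y 0 = 0" by (simp add: Y_def \<Phi>0)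
        show "frechet_derivative Y (at 0) ?e1 $ 1 = 0" "frechet_derivative Y (at 0) ?e2 $ 1 = 0"
          unfolding DY vector_add_component vector_scaleR_component D\<Phi> by simp_all
      qed
      show "X = \<Phi> ?z"
        using Y0 unfolding Y_def scaleR_minus1_left add_uminus_conv_diff right_minus_eq by (rule ext)
    qed simp
    then show "range \<Phi> = killing \<Gamma>" using in_killing by blast
  qed
qed

lemma killing_iff_exponential:
  assumes "a \<noteq> 0"
  shows "X \<in> killing \<Gamma> \<longleftrightarrow> (\<exists>X0 \<in> killing0. \<exists>\<xi>.
    (\<forall>t. \<xi> differentiable (at t) \<and> deriv \<xi> differentiable (at t) \<and>
      deriv (deriv \<xi>) t + P * deriv \<xi> t + a * e * \<xi> t = 0) \<and>
    X = (\<lambda>p. (exp (- a * p $ 1) * \<xi> (p $ 2)) *\<^sub>R coord_field 1 p) + X0)" (is "_ \<longleftrightarrow> ?R")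
proof
  assume "X \<in> killing \<Gamma>"
  then obtain \<xi> \<xi>' \<delta> c where "a = 0 \<or> \<delta> = 0" "linear_ode P (a * e) (\<delta> * e) \<xi> \<xi>'"
    "X = normal_field a \<xi> \<delta> c" by (rule killing_normal_field)
  moreover from this have "\<xi>' = deriv \<xi>" by (intro linear_ode_deriv_eq)
  ultimately have "linear_ode P (a * e) 0 \<xi> (deriv \<xi>)"
    "X = (\<lambda>p. (exp (- a * p $ 1) * \<xi> (p $ 2)) *\<^sub>R coord_field 1 p) + (\<lambda>_. c)"
    using assms by (auto simp: normal_field_def coord_field_def fun_eq_iff)
  then show ?R
    unfolding killing0_eq linear_ode_deriv
    by (intro bexI[of _ "\<lambda>_. c"] exI[of _ \<xi>] conjI rangeI)
next
  assume ?R
  then obtain X0 \<xi> where X0: "X0 \<in> killing0" and "linear_ode P (a * e) 0 \<xi> (deriv \<xi>)"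
    "X = (\<lambda>p. (exp (- a * p $ 1) * \<xi> (p $ 2)) *\<^sub>R coord_field 1 p) + X0"
    unfolding linear_ode_deriv by (elim bexE exE conjE) (rule that)
  moreover obtain c where "X0 = (\<lambda>_. c)" using X0 unfolding killing0_eq by (rule rangeE)
  ultimately show "X \<in> killing \<Gamma>"
    using normal_field_killing[of 0 \<xi> "deriv \<xi>" c]
    by (simp add: normal_field_def coord_field_def plus_fun_def)
qed

lemma killing_iff_affine:
  assumes "a = 0"
  shows "X \<in> killing \<Gamma> \<longleftrightarrow> (\<exists>X0 \<in> killing0. \<exists>c1 \<xi>.
    (\<forall>t. \<xi> differentiable (at t) \<and> deriv \<xi> differentiable (at t) \<and>
      deriv (deriv \<xi>) t + P * deriv \<xi> t - c1 * e = 0) \<and>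
    X = (\<lambda>p. (\<xi> (p $ 2) + c1 * p $ 1) *\<^sub>R coord_field 1 p) + X0)" (is "_ \<longleftrightarrow> ?R")
proof -
  have ode: "(\<forall>t. \<xi> differentiable (at t) \<and> deriv \<xi> differentiable (at t) \<and>
      deriv (deriv \<xi>) t + P * deriv \<xi> t - c1 * e = 0) \<longleftrightarrow> linear_ode P 0 (c1 * e) \<xi> (deriv \<xi>)" for \<xi> c1
    unfolding linear_ode_deriv[symmetric] by simp
  show ?thesis
  proof
    assume "X \<in> killing \<Gamma>"
    then obtain \<xi> \<xi>' \<delta> c where "a = 0 \<or> \<delta> = 0" "linear_ode P (a * e) (\<delta> * e) \<xi> \<xi>'"
      "X = normal_field a \<xi> \<delta> c" by (rule killing_normal_field)
    moreover from this have "\<xi>' = deriv \<xi>" by (intro linear_ode_deriv_eq)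
    ultimately have "linear_ode P 0 (\<delta> * e) \<xi> (deriv \<xi>)"
      "X = (\<lambda>p. (\<xi> (p $ 2) + \<delta> * p $ 1) *\<^sub>R coord_field 1 p) + (\<lambda>_. c)"
      using assms by (auto simp: normal_field_def coord_field_def fun_eq_iff)
    then show ?R
      unfolding killing0_eq ode
      by (intro bexI[of _ "\<lambda>_. c"] exI[of _ \<delta>] exI[of _ \<xi>] conjI rangeI)
  next
    assume ?R
    then obtain X0 c1 \<xi> where X0: "X0 \<in> killing0" and "linear_ode P 0 (c1 * e) \<xi> (deriv \<xi>)"
      "X = (\<lambda>p. (\<xi> (p $ 2) + c1 * p $ 1) *\<^sub>R coord_field 1 p) + X0"
      unfolding ode by (elim bexE exE conjE) (rule that)
    moreover obtain c where "X0 = (\<lambda>_. c)" using X0 unfolding killing0_eq by (rule rangeE)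
    ultimately show "X \<in> killing \<Gamma>"
      using normal_field_killing[of c1 \<xi> "deriv \<xi>" c] assms
      by (simp add: normal_field_def coord_field_def plus_fun_def)
  qed
qed

end

section \<open>Dimension counts in arbitrary linear coordinates\<close>

lemma edim_killing_degenerate:
  fixes \<Gamma> :: "2 \<Rightarrow> 2 \<Rightarrow> 2 \<Rightarrow> real"
  assumes sym: "\<And>i j k. \<Gamma> i j k = \<Gamma> j i k" and nf: "\<not> flat \<Gamma>" and deg: "\<not> ric_nondegenerate \<Gamma>"
  shows "edim (killing \<Gamma>) = 4"
proof -
  obtain \<kappa> where \<kappa>: "\<kappa> \<noteq> 0" "\<And>v. ric \<Gamma> v \<kappa> = 0"
    using deg by (auto simp: ric_nondegenerate_def)
  define N where "N = \<kappa> $ 1 * \<kappa> $ 1 + \<kappa> $ 2 * \<kappa> $ 2"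
  have N: "N \<noteq> 0" using \<kappa>(1) by (simp add: N_def vec_eq_iff forall_2 sum_squares_eq_zero_iff)
  \<comment> \<open>In complex notation \<open>S\<close> is multiplication by the kernel vector
    \<open>\<kappa>\<close> and \<open>T\<close> is multiplication by its inverse, with
    \<open>N\<close> the squared modulus. Thus \<open>S\<close> sends the first axis to the kernel
    of the Ricci form.\<close>
  define S :: "real^2 \<Rightarrow> real^2" where
    "S v = vector [\<kappa> $ 1 * v $ 1 - \<kappa> $ 2 * v $ 2, \<kappa> $ 2 * v $ 1 + \<kappa> $ 1 * v $ 2]" for v
  define T :: "real^2 \<Rightarrow> real^2" where
    "T w = vector [(\<kappa> $ 1 * w $ 1 + \<kappa> $ 2 * w $ 2) / N, (\<kappa> $ 1 * w $ 2 - \<kappa> $ 2 * w $ 1) / N]" for w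
  have lin: "linear S" "linear T"
    by (auto intro!: linearI simp: S_def T_def vec_eq_iff forall_2 add_divide_distrib diff_divide_distrib algebra_simps)
  have ST: "S (T v) = v" and TS: "T (S v) = v" for v
    using N by (simp_all add: S_def T_def vec_eq_iff forall_2 field_simps) (simp_all add: N_def algebra_simps)
  have Se1: "S (axis 1 1) = \<kappa>" by (simp add: S_def vec_eq_iff forall_2 axis_def)
  define \<Gamma>' where "\<Gamma>' i j k = T (christoffel \<Gamma> (S (axis i 1)) (S (axis j 1))) $ k" for i j k
  have \<Gamma>': "christoffel \<Gamma>' v w = T (christoffel \<Gamma> (S v) (S w))" for v w
    by (subst (2) vec2_expand[of v], subst (2) vec2_expand[of w])
      (simp add: vec_eq_iff christoffel_2 \<Gamma>'_def linear_add lin linear_scale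
        christoffel.add_left christoffel.add_right christoffel.scaleR_left christoffel.scaleR_right
        algebra_simps)
  note ric' = ric_conj[OF lin(2,1) ST \<Gamma>']
  interpret N: degenerate_normal_form \<Gamma>'
  proof
    show sym': "\<Gamma>' i j k = \<Gamma>' j i k" for i j k
      unfolding \<Gamma>'_def by (subst christoffel_sym[OF sym]) simp
    show "ric \<Gamma>' (axis 1 1) (axis 1 1) = 0" by (simp add: ric' Se1 \<kappa>)
    show "ric \<Gamma>' (axis 1 1) (axis 2 1) = 0"
      using ric_sym[of \<Gamma> \<kappa>, OF sym] by (simp add: ric' Se1 \<kappa>)
    obtain v w where "ric \<Gamma> v w \<noteq> 0" using ric_neq_0[OF sym nf] .
    then have "ric \<Gamma>' (T v) (T w) \<noteq> 0" by (simp add: ric' ST)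
    then show "\<exists>v w. ric \<Gamma>' v w \<noteq> 0" by blast
  qed
  obtain \<Phi> :: "(real^2) \<times> (real^2) \<Rightarrow> 2 vfield" where
    \<Phi>: "linear \<Phi>" "inj \<Phi>" "range \<Phi> = killing \<Gamma>'" using N.killing_parametrization .
  \<comment> \<open>The parametrization found in the adapted coordinates is transported back by the
    inverse coordinate change.\<close>
  define \<Psi> where "\<Psi> z = (\<lambda>p. S (\<Phi> z (T p)))" for z
  have \<Gamma>: "christoffel \<Gamma> v w = S (christoffel \<Gamma>' (T v) (T w))" for v w
    by (simp add: \<Gamma>' ST)
  have "linear \<Psi>"
    by (intro linearI) (simp_all add: \<Psi>_def linear_add[OF \<Phi>(1)] linear_scale[OF \<Phi>(1)]
        linear_add[OF lin(1)] linear_scale[OF lin(1)] scaleR_fun_def fun_eq_iff)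
  moreover have \<Phi>\<Psi>: "\<Phi> z = (\<lambda>p. T (\<Psi> z (S p)))" for z by (simp add: \<Psi>_def TS)
  have "inj \<Psi>"
  proof (rule injI)
    fix z z' assume "\<Psi> z = \<Psi> z'"
    then have "\<Phi> z = \<Phi> z'" by (simp add: \<Phi>\<Psi>)
    then show "z = z'" using \<Phi>(2) by (simp add: inj_eq)
  qed
  moreover have "range \<Psi> = killing \<Gamma>"
  proof (intro equalityI subsetI)
    fix X assume "X \<in> range \<Psi>"
    then obtain z where "X = \<Psi> z" by blast
    moreover have "\<Phi> z \<in> killing \<Gamma>'" using \<Phi>(3) by blast
    ultimately show "X \<in> killing \<Gamma>"
      using killing_conj[OF _ lin TS \<Gamma>] by (simp add: \<Psi>_def)
  next
    fix X assume "X \<in> killing \<Gamma>"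
    from killing_conj[OF this lin(2,1) ST \<Gamma>'] obtain z where "\<Phi> z = (\<lambda>p. T (X (S p)))"
      using \<Phi>(3) by (metis (no_types, lifting) imageE)
    then have "\<Psi> z = X" by (simp add: \<Psi>_def ST)
    then show "X \<in> range \<Psi>" by blast
  qed
  ultimately have "edim (killing \<Gamma>) = enat (DIM((real^2) \<times> (real^2)))"
    using edim_range[of \<Psi>] by simp
  then show ?thesis by (simp add: numeral_eq_enat)
qed

lemma edim_killing_nondegenerate:
  fixes \<Gamma> :: "2 \<Rightarrow> 2 \<Rightarrow> 2 \<Rightarrow> real"
  assumes "\<And>i j k. \<Gamma> i j k = \<Gamma> j i k" and "ric_nondegenerate \<Gamma>"
  shows "edim (killing \<Gamma>) = 2"
proof -
  let ?c = "\<lambda>(c :: real^2) (_ :: real^2). c"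
  have "killing \<Gamma> = range ?c"
    using killing_const_if_nondegenerate[OF assms] killing_const by blast
  moreover have "linear ?c" by (intro linearI) (auto simp: scaleR_fun_def)
  moreover have "inj ?c" by (auto intro!: injI dest: fun_cong)
  ultimately show ?thesis using edim_range[of ?c] by (simp add: numeral_eq_enat)
qed

section \<open>Assembly of the three assertions\<close>

theorem theorem3p4:
  fixes \<Gamma> :: "2 \<Rightarrow> 2 \<Rightarrow> 2 \<Rightarrow> real"
  assumes torsion_free: "\<And>i j k. \<Gamma> i j k = \<Gamma> j i k"
    and not_flat: "\<not> flat \<Gamma>"
  shows
    "((\<forall>X Y p. smooth X \<longrightarrow> smooth Y \<longrightarrow>
         ricci \<Gamma> X Y p = ricci \<Gamma> (coord_field 2) (coord_field 2) p * (X p $ 2 * Y p $ 2)) \<longrightarrow>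
       (\<Gamma> 1 1 1 \<noteq> 0 \<longrightarrow>
         (\<forall>X. X \<in> killing \<Gamma> \<longleftrightarrow>
           (\<exists>X0 \<in> killing0. \<exists>\<xi> :: real \<Rightarrow> real.
              (\<forall>t. \<xi> differentiable (at t) \<and> deriv \<xi> differentiable (at t) \<and>
                 deriv (deriv \<xi>) t + (2 * \<Gamma> 1 2 1 - \<Gamma> 2 2 2) * deriv \<xi> t
                   + \<Gamma> 1 1 1 * \<Gamma> 2 2 1 * \<xi> t = 0) \<and>
              X = (\<lambda>p. (exp (- \<Gamma> 1 1 1 * p $ 1) * \<xi> (p $ 2)) *\<^sub>R coord_field 1 p) + X0))) \<and>
       (\<Gamma> 1 1 1 = 0 \<longrightarrow>
         (\<forall>X. X \<in> killing \<Gamma> \<longleftrightarrow>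
           (\<exists>X0 \<in> killing0. \<exists>c1 :: real. \<exists>\<xi> :: real \<Rightarrow> real.
              (\<forall>t. \<xi> differentiable (at t) \<and> deriv \<xi> differentiable (at t) \<and>
                 deriv (deriv \<xi>) t + (2 * \<Gamma> 1 2 1 - \<Gamma> 2 2 2) * deriv \<xi> t
                   - c1 * \<Gamma> 2 2 1 = 0) \<and>
              X = (\<lambda>p. (\<xi> (p $ 2) + c1 * p $ 1) *\<^sub>R coord_field 1 p) + X0))))
     \<and> ((edim (killing \<Gamma>) = 4 \<longleftrightarrow> edim (killing \<Gamma>) > 2) \<and>
        (edim (killing \<Gamma>) > 2 \<longleftrightarrow> ricci_has_rank \<Gamma> 1))
     \<and> (edim (killing \<Gamma>) = 2 \<longleftrightarrow> ricci_has_rank \<Gamma> 2)"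
proof (rule conjI, rule impI)
  assume ricci: "\<forall>X Y p. smooth X \<longrightarrow> smooth Y \<longrightarrow>
         ricci \<Gamma> X Y p = ricci \<Gamma> (coord_field 2) (coord_field 2) p * (X p $ 2 * Y p $ 2)"
  interpret degenerate_normal_form \<Gamma>
  proof
    \<comment> \<open>Coordinate fields as test fields: the second component of
      \<open>coord_field 1\<close> is 0.\<close>
    have "ric \<Gamma> (axis 1 1) (axis j 1) = 0" for j
      using ricci[rule_format, of "coord_field 1" "coord_field j" 0]
      by (simp add: ricci_coord_field) (simp add: coord_field_def axis_def)
    then show "ric \<Gamma> (axis 1 1) (axis 1 1) = 0" "ric \<Gamma> (axis 1 1) (axis 2 1) = 0" by blast+
    show "\<exists>v w. ric \<Gamma> v w \<noteq> 0" using ric_neq_0[OF torsion_free not_flat] by blast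
  qed (rule torsion_free)
  show "(\<Gamma> 1 1 1 \<noteq> 0 \<longrightarrow>
         (\<forall>X. X \<in> killing \<Gamma> \<longleftrightarrow>
           (\<exists>X0 \<in> killing0. \<exists>\<xi> :: real \<Rightarrow> real.
              (\<forall>t. \<xi> differentiable (at t) \<and> deriv \<xi> differentiable (at t) \<and>
                 deriv (deriv \<xi>) t + (2 * \<Gamma> 1 2 1 - \<Gamma> 2 2 2) * deriv \<xi> t
                   + \<Gamma> 1 1 1 * \<Gamma> 2 2 1 * \<xi> t = 0) \<and>
              X = (\<lambda>p. (exp (- \<Gamma> 1 1 1 * p $ 1) * \<xi> (p $ 2)) *\<^sub>R coord_field 1 p) + X0))) \<and>
       (\<Gamma> 1 1 1 = 0 \<longrightarrow>
         (\<forall>X. X \<in> killing \<Gamma> \<longleftrightarrow>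
           (\<exists>X0 \<in> killing0. \<exists>c1 :: real. \<exists>\<xi> :: real \<Rightarrow> real.
              (\<forall>t. \<xi> differentiable (at t) \<and> deriv \<xi> differentiable (at t) \<and>
                 deriv (deriv \<xi>) t + (2 * \<Gamma> 1 2 1 - \<Gamma> 2 2 2) * deriv \<xi> t
                   - c1 * \<Gamma> 2 2 1 = 0) \<and>
              X = (\<lambda>p. (\<xi> (p $ 2) + c1 * p $ 1) *\<^sub>R coord_field 1 p) + X0)))"
    using killing_iff_exponential killing_iff_affine by blast
next
  \<comment> \<open>Rank and dimension are both decided by nondegeneracy, with pairs 2, 2 and 1, 4
    only, so the equivalences become comparisons of numerals.\<close>
  have "ricci_has_rank \<Gamma> r \<longleftrightarrow> r = (if ric_nondegenerate \<Gamma> then 2 else 1)" for r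
    unfolding ricci_has_rank_def rank_ricci_matrix[OF torsion_free not_flat] by auto
  moreover have "edim (killing \<Gamma>) = (if ric_nondegenerate \<Gamma> then 2 else 4)"
    using edim_killing_nondegenerate[OF torsion_free] edim_killing_degenerate[OF torsion_free not_flat]
    by simp
  ultimately show "((edim (killing \<Gamma>) = 4 \<longleftrightarrow> edim (killing \<Gamma>) > 2) \<and>
        (edim (killing \<Gamma>) > 2 \<longleftrightarrow> ricci_has_rank \<Gamma> 1))
     \<and> (edim (killing \<Gamma>) = 2 \<longleftrightarrow> ricci_has_rank \<Gamma> 2)"
    by simp
qed

end
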